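(* Let $\mathcal{R}$ be a finite commutative chain ring with maximal ideal $\langle\gamma\rangle$ and nilpotency index $s$, and let $q$ be the size of its residue field. For each subtype $(k_0,\dots,k_{s-1})$ there exists a constant weight code $\mathcal{C}$ of minimal length which is unique up to equivalence. The generator matrix of $\mathcal{C}$ contains exactly $\frac{|\mathfrak{O}|}{q-1}$ elements from each non-zero $\mathcal{R}^\times$-orbit $$\mathfrak{O}\subset V:=\mathcal{R}^{k_0}\times\langle\gamma\rangle^{k_1}\times\dots\times\langle\gamma^{s-1}\rangle^{k_{s-1}}$$ as columns. $\mathcal{C}$ has length $\frac{|V|-1}{q-1}$ and constant weight $\frac{|V|}{q-1}$, where $|V|=\prod_{i=0}^{s-1}q^{k_i(s-i)}$. Each constant weight code of the same subtype is, up to equivalence, an $\ell$-fold replication of $\mathcal{C}$.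
   Context: $\mathcal{R}$ is a finite commutative chain ring with maximal ideal $\langle\gamma\rangle$; $s$ is the least positive integer with $\gamma^s=0$ (and $\gamma^0=1$); $q=|\mathcal{R}/\langle\gamma\rangle|$; $\mathcal{R}^\times$ is the unit group. A linear code of length $n$ is an $\mathcal{R}$-submodule $\mathcal{C}\subseteq\mathcal{R}^n$; all codes here are linear. It has subtype $(k_0,\dots,k_{s-1})$ (a tuple of non-negative integers) if $\mathcal{C}\cong(\mathcal{R}/\gamma^s\mathcal{R})^{k_0}\times(\mathcal{R}/\gamma^{s-1}\mathcal{R})^{k_1}\times\cdots\times(\mathcal{R}/\gamma\mathcal{R})^{k_{s-1}}$ as $\mathcal{R}$-modules; this tuple is unique, and $K=\sum_{i=0}^{s-1} k_i$ is the rank (the minimal number of generators). A generator matrix is a matrix in $\mathcal{R}^{K\times n}$ whose rows span the code. Homogeneous weight: for $x\in\mathcal{R}$, $\mathrm{wt}_{\mathrm{Hom}}(x)=0$ if $x=0$, $=\frac{q}{q-1}$ if $x\in\langle\gamma^{s-1}\rangle\setminus\{0\}$, and $=1$ if $x\notin\langle\gamma^{s-1}\rangle$; for $x\in\mathcal{R}^n$, $\mathrm{wt}_{\mathrm{Hom}}(x)=\sum_{i=1}^n\mathrm{wt}_{\mathrm{Hom}}(x_i)$. A code $\mathcal{C}$ has constant (homogeneous) weight $w$ if $\mathrm{wt}_{\mathrm{Hom}}(c)=w$ for all $c\in\mathcal{C}\setminus\{0\}$. "Minimal length" means minimal among the constant weight codes of the given subtype. Two codes $\mathcal{C},\mathcal{C}'$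 over $\mathcal{R}$ of length $n$ are equivalent if there are a vector of units $(u_1,\dots,u_n)\in(\mathcal{R}^\times)^n$ and a permutation $\sigma\in S_n$ with $\mathcal{C}'=\{(c_{\sigma(1)}u_{\sigma(1)},\dots,c_{\sigma(n)}u_{\sigma(n)}): c\in\mathcal{C}\}$. For a positive integer $\ell$, a code $\mathcal{C}'$ is an $\ell$-fold replication of $\mathcal{C}$ if $\mathcal{C}'=\{(c,\dots,c)\ (\ell\text{ times}): c\in\mathcal{C}\}$. The group $\mathcal{R}^\times$ acts on $V\subseteq\mathcal{R}^K$ by scalar multiplication; $\mathcal{R}^\times$-orbits are the orbits of this action, a non-zero orbit is one other than $\{0\}$, and elements of $V$ are regarded as column vectors.
   Formalization: In the last claim, a constant weight code is shown to be, up to equivalence, an ℓ-fold replication of C with as many zero coordinates appended as the code has identically zero coordinates; without this the claim fails, e.g. for {00,10} over F_2. *)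

theory Defs
  imports
    "Jordan_Normal_Form.Matrix"
    "HOL-Library.FuncSet"
    "HOL-Library.Set_Algebras"
    "HOL-Combinatorics.Permutations"
begin

text \<open>The ring is the type \<open>'a :: {comm_ring_1, finite}\<close>; \<open>module.subspace (*) I\<close> says that
  \<open>I\<close> is a submodule of the ring over itself, that is, an ideal.\<close>

abbreviation is_ideal :: "'a::comm_ring_1 set \<Rightarrow> bool" where
  "is_ideal \<equiv> module.subspace (*)"

definition chain_ring :: "'a::{comm_ring_1,finite} itself \<Rightarrow> bool" where
  "chain_ring _ \<longleftrightarrow> (\<forall>I J :: 'a set. is_ideal I \<longrightarrow> is_ideal J \<longrightarrow> I \<subseteq> J \<or> J \<subseteq> I)"

definition maximal_ideal :: "'a::comm_ring_1 set \<Rightarrow> bool" where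
  "maximal_ideal I \<longleftrightarrow> is_ideal I \<and> I \<noteq> UNIV \<and> (\<forall>J. is_ideal J \<longrightarrow> I \<subseteq> J \<longrightarrow> J = I \<or> J = UNIV)"

definition ideal_gen :: "'a::comm_ring_1 \<Rightarrow> 'a set" where
  "ideal_gen a = {x. a dvd x}"

definition nilpotency_index :: "'a::comm_ring_1 \<Rightarrow> nat" where
  "nilpotency_index a = (LEAST s. 0 < s \<and> a ^ s = 0)"

text \<open>The quotient by an ideal \<open>I\<close> is the set of its cosets. Cosets are added as sets, and the
  scalar multiple of a coset is the coset containing the elementwise multiple.\<close>

definition quot :: "'a::comm_ring_1 set \<Rightarrow> 'a set set" where
  "quot I = range (\<lambda>x. x +o I)"

definition quot_scale :: "'a::comm_ring_1 set \<Rightarrow> 'a \<Rightarrow> 'a set \<Rightarrow> 'a set" where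
  "quot_scale I r A = (r *o A) + I"

definition residue_size :: "'a::{comm_ring_1,finite} \<Rightarrow> nat" where
  "residue_size \<gamma> = card (quot (ideal_gen \<gamma>))"

definition linear_code :: "nat \<Rightarrow> 'a::comm_ring_1 vec set \<Rightarrow> bool" where
  "linear_code n C \<longleftrightarrow> C \<subseteq> carrier_vec n \<and> 0\<^sub>v n \<in> C
     \<and> (\<forall>c\<in>C. \<forall>d\<in>C. c + d \<in> C) \<and> (\<forall>r. \<forall>c\<in>C. r \<cdot>\<^sub>v c \<in> C)"

text \<open>A tuple \<open>(k 0, \<dots>, k (s - 1))\<close> is a function \<open>k\<close> of which only the values below
  \<open>s = nilpotency_index \<gamma>\<close> are ever used. The factors of the product of the modules
  \<open>(R / \<gamma>^(s - i) R)^(k i)\<close> are indexed by the pairs \<open>(i, j)\<close> with \<open>i < s\<close> and \<open>j < k i\<close>.\<close>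

definition subtype_index :: "'a::comm_ring_1 \<Rightarrow> (nat \<Rightarrow> nat) \<Rightarrow> (nat \<times> nat) set" where
  "subtype_index \<gamma> k = (SIGMA i : {..<nilpotency_index \<gamma>}. {..<k i})"

definition subtype_ideal :: "'a::comm_ring_1 \<Rightarrow> nat \<times> nat \<Rightarrow> 'a set" where
  "subtype_ideal \<gamma> p = ideal_gen (\<gamma> ^ (nilpotency_index \<gamma> - fst p))"

definition has_subtype :: "'a::comm_ring_1 \<Rightarrow> (nat \<Rightarrow> nat) \<Rightarrow> 'a vec set \<Rightarrow> bool" where
  "has_subtype \<gamma> k C \<longleftrightarrow> (\<exists>\<phi> :: 'a vec \<Rightarrow> nat \<times> nat \<Rightarrow> 'a set.
     bij_betw \<phi> C (\<Pi>\<^sub>E p \<in> subtype_index \<gamma> k. quot (subtype_ideal \<gamma> p)) \<and>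
     (\<forall>c\<in>C. \<forall>d\<in>C. \<forall>p \<in> subtype_index \<gamma> k. \<phi> (c + d) p = \<phi> c p + \<phi> d p) \<and>
     (\<forall>r. \<forall>c\<in>C. \<forall>p \<in> subtype_index \<gamma> k.
        \<phi> (r \<cdot>\<^sub>v c) p = quot_scale (subtype_ideal \<gamma> p) r (\<phi> c p)))"

definition code_rank :: "'a::comm_ring_1 \<Rightarrow> (nat \<Rightarrow> nat) \<Rightarrow> nat" where
  "code_rank \<gamma> k = (\<Sum>i<nilpotency_index \<gamma>. k i)"

definition generator_matrix :: "nat \<Rightarrow> nat \<Rightarrow> 'a::comm_ring_1 mat \<Rightarrow> 'a vec set \<Rightarrow> bool" where
  "generator_matrix K n G C \<longleftrightarrow>
     G \<in> carrier_mat K n \<and> C = (\<lambda>x. transpose_mat G *\<^sub>v x) ` carrier_vec K"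

definition wt_elem :: "'a::{comm_ring_1,finite} \<Rightarrow> 'a \<Rightarrow> real" where
  "wt_elem \<gamma> x =
     (if x = 0 then 0
      else if x \<in> ideal_gen (\<gamma> ^ (nilpotency_index \<gamma> - 1))
        then real (residue_size \<gamma>) / (real (residue_size \<gamma>) - 1)
      else 1)"

definition wt_hom :: "'a::{comm_ring_1,finite} \<Rightarrow> 'a vec \<Rightarrow> real" where
  "wt_hom \<gamma> x = (\<Sum>i<dim_vec x. wt_elem \<gamma> (x $ i))"

definition constant_weight :: "'a::{comm_ring_1,finite} \<Rightarrow> nat \<Rightarrow> 'a vec set \<Rightarrow> real \<Rightarrow> bool" where
  "constant_weight \<gamma> n C w \<longleftrightarrow> (\<forall>c \<in> C - {0\<^sub>v n}. wt_hom \<gamma> c = w)"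

definition constant_weight_code ::
  "'a::{comm_ring_1,finite} \<Rightarrow> (nat \<Rightarrow> nat) \<Rightarrow> nat \<Rightarrow> 'a vec set \<Rightarrow> bool" where
  "constant_weight_code \<gamma> k n C \<longleftrightarrow>
     linear_code n C \<and> has_subtype \<gamma> k C \<and> (\<exists>w. constant_weight \<gamma> n C w)"

definition minimal_constant_weight_code ::
  "'a::{comm_ring_1,finite} \<Rightarrow> (nat \<Rightarrow> nat) \<Rightarrow> nat \<Rightarrow> 'a vec set \<Rightarrow> bool" where
  "minimal_constant_weight_code \<gamma> k n C \<longleftrightarrow>
     constant_weight_code \<gamma> k n C \<and> (\<forall>m D. constant_weight_code \<gamma> k m D \<longrightarrow> n \<le> m)"

definition code_equiv :: "nat \<Rightarrow> 'a::comm_ring_1 vec set \<Rightarrow> 'a vec set \<Rightarrow> bool" where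
  "code_equiv n C C' \<longleftrightarrow> C \<subseteq> carrier_vec n \<and>
     (\<exists>u \<sigma>. (\<forall>i<n. u i dvd 1) \<and> \<sigma> permutes {..<n} \<and>
        C' = (\<lambda>c. vec n (\<lambda>i. c $ \<sigma> i * u (\<sigma> i))) ` C)"

definition replication :: "nat \<Rightarrow> 'a vec set \<Rightarrow> 'a vec set" where
  "replication l C = (\<lambda>c. vec (l * dim_vec c) (\<lambda>i. c $ (i mod dim_vec c))) ` C"

text \<open>Appending zero coordinates changes neither the subtype nor the weights of a code, and destroys
  being a replication; hence replications are compared with a code up to its zero coordinates.
  A code without zero coordinates is compared with the replication itself.\<close>

definition zero_coords :: "nat \<Rightarrow> 'a::comm_ring_1 vec set \<Rightarrow> nat set" where
  "zero_coords n C = {i. i < n \<and> (\<forall>c\<in>C. c $ i = 0)}"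

definition append_zeros :: "nat \<Rightarrow> 'a::comm_ring_1 vec set \<Rightarrow> 'a vec set" where
  "append_zeros z C = (\<lambda>c. c @\<^sub>v 0\<^sub>v z) ` C"

lemma append_zeros_0: "append_zeros 0 C = C"
proof -
  have "c @\<^sub>v 0\<^sub>v 0 = c" for c :: "'a vec"
    by (rule eq_vecI) auto
  then show ?thesis by (simp add: append_zeros_def)
qed

text \<open>The product of the \<open>\<langle>\<gamma>^i\<rangle>^(k i)\<close>, inside the column vectors of length
  \<open>code_rank \<gamma> k\<close>: block \<open>i\<close> starts at position \<open>k 0 + \<dots> + k (i - 1)\<close>.\<close>

definition column_space :: "'a::comm_ring_1 \<Rightarrow> (nat \<Rightarrow> nat) \<Rightarrow> 'a vec set" where
  "column_space \<gamma> k = {v \<in> carrier_vec (code_rank \<gamma> k).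
     \<forall>i < nilpotency_index \<gamma>. \<forall>j < k i. v $ ((\<Sum>l<i. k l) + j) \<in> ideal_gen (\<gamma> ^ i)}"

definition unit_orbit :: "'a::comm_ring_1 vec \<Rightarrow> 'a vec set" where
  "unit_orbit v = {u \<cdot>\<^sub>v v | u. u dvd 1}"

definition nonzero_orbits :: "'a::comm_ring_1 \<Rightarrow> (nat \<Rightarrow> nat) \<Rightarrow> 'a vec set set" where
  "nonzero_orbits \<gamma> k = unit_orbit ` column_space \<gamma> k - {{0\<^sub>v (code_rank \<gamma> k)}}"

text \<open>Equal columns at different positions are counted separately: codes are only classified up to
  units, which move a column freely within its orbit.\<close>

definition balanced_columns ::
  "'a::{comm_ring_1,finite} \<Rightarrow> (nat \<Rightarrow> nat) \<Rightarrow> nat \<Rightarrow> 'a mat \<Rightarrow> bool" where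
  "balanced_columns \<gamma> k n G \<longleftrightarrow> (\<forall>\<OO> \<in> nonzero_orbits \<gamma> k.
     real (card {j. j < n \<and> col G j \<in> \<OO>}) = real (card \<OO>) / (real (residue_size \<gamma>) - 1))"

end

theory Submission
  imports Defs
begin

text \<open>
  A code of the given subtype is the image of \<open>R^K\<close> under \<open>x \<mapsto> (h j \<bullet> x)\<^sub>j\<close> for columns \<open>h j\<close> in
  \<open>V\<close>, with the kernel prescribed by the subtype, so only the number of columns in each unit orbit
  matters. The functions \<open>x \<mapsto> 1 - wt (v \<bullet> x)\<close> on \<open>R^K\<close> are orthogonal for \<open>v\<close> in different
  orbits: if some \<open>x0\<close> is killed by \<open>v\<close> but not by \<open>v'\<close>, translations along multiples of \<open>x0\<close>
  average \<open>1 - wt (v' \<bullet> x)\<close> over a coset of the socle, which gives \<open>0\<close>; and if \<open>v\<close> and \<open>v'\<close> kill the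
  same vectors, they differ by a unit. Pairing the weight function of a code of constant weight
  \<open>w\<close> with \<open>1 - wt (v \<bullet> x)\<close> therefore determines the number of columns in the orbit of \<open>v\<close> up to a
  constant that depends only on \<open>v\<close>; comparing with the code that has all of \<open>V\<close> as columns
  shows that this number is \<open>w / |V|\<close> times the size of the orbit. The orbits in the socle have
  \<open>q - 1\<close> elements and every nonzero orbit has a multiple of \<open>q - 1\<close>, so \<open>w (q - 1) / |V|\<close> is an integer
  \<open>l\<close>, and \<open>l = 1\<close> occurs.
\<close>

section \<open>Finite chain rings\<close>

lemma is_ideal_iff:
  "is_ideal I \<longleftrightarrow> 0 \<in> I \<and> (\<forall>x\<in>I. \<forall>y\<in>I. x + y \<in> I) \<and> (\<forall>c. \<forall>x\<in>I. c * x \<in> (I :: 'a::comm_ring_1 set))"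
proof -
  interpret m: Modules.module "(*) :: 'a \<Rightarrow> 'a \<Rightarrow> 'a"
    by unfold_locales (auto simp: algebra_simps)
  show ?thesis by (rule m.subspace_def)
qed

lemma is_ideal_ideal_gen: "is_ideal (ideal_gen a)"
  by (auto simp: is_ideal_iff ideal_gen_def)

lemma coset_eq_iff:
  assumes "is_ideal I"
  shows "x +o I = y +o I \<longleftrightarrow> x - y \<in> I"
proof
  have 0: "0 \<in> I" and add: "a \<in> I \<Longrightarrow> b \<in> I \<Longrightarrow> a + b \<in> I" and mult: "a \<in> I \<Longrightarrow> c * a \<in> I" for a b c
    using assms by (auto simp: is_ideal_iff)
  show "x - y \<in> I" if "x +o I = y +o I"
  proof -
    have "x \<in> x +o I" using 0 by (auto simp: elt_set_plus_def intro!: bexI[of _ 0])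
    then have "x \<in> y +o I" by (simp only: that)
    then obtain b where "b \<in> I" "x = y + b" by (auto simp: elt_set_plus_def)
    then show ?thesis by simp
  qed
  assume d: "x - y \<in> I"
  have d': "y - x \<in> I" using mult[OF d, of "-1"] by simp
  show "x +o I = y +o I"
    using add[OF d] add[OF d'] by (force simp: elt_set_plus_def algebra_simps)
qed

lemma coset_add:
  assumes "is_ideal I"
  shows "(x +o I) + (y +o I) = (x + y) +o I"
proof -
  have "I + I = I"
    using assms by (force simp: is_ideal_iff set_plus_def)
  then show ?thesis by (simp add: set_plus_rearrange)
qed

text \<open>The elementwise multiple \<open>r *o A\<close> can be smaller than a coset; adding
  \<open>I\<close> completes it to one.\<close>

lemma quot_scale_coset:
  assumes "is_ideal I"
  shows "quot_scale I r (x +o I) = (r * x) +o I"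
proof -
  have 0: "0 \<in> I" and add: "a \<in> I \<Longrightarrow> b \<in> I \<Longrightarrow> a + b \<in> I" and mult: "a \<in> I \<Longrightarrow> c * a \<in> I" for a b c
    using assms by (auto simp: is_ideal_iff)
  show ?thesis
  proof (intro equalityI subsetI)
    fix z assume "z \<in> quot_scale I r (x +o I)"
    then obtain b c where "b \<in> I" "c \<in> I" "z = r * (x + b) + c"
      by (auto simp: quot_scale_def elt_set_plus_def elt_set_times_def set_plus_def)
    then have "z = r * x + (r * b + c)" "r * b + c \<in> I"
      using add mult by (auto simp: algebra_simps)
    then show "z \<in> (r * x) +o I" unfolding elt_set_plus_def by blast
  next
    fix z assume "z \<in> (r * x) +o I"
    then obtain c where "c \<in> I" "z = r * (x + 0) + c" by (auto simp: elt_set_plus_def)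
    then show "z \<in> quot_scale I r (x +o I)"
      unfolding quot_scale_def elt_set_plus_def elt_set_times_def set_plus_def using 0 by blast
  qed
qed

section \<open>Counting by fibres\<close>

lemma card_fibres:
  assumes "finite A" and "\<And>y. y \<in> f ` A \<Longrightarrow> card {x \<in> A. f x = y} = h"
  shows "card A = card (f ` A) * h"
proof -
  have "card A = (\<Sum>y\<in>f ` A. card {x \<in> A. f x = y})"
    using sum.image_gen[OF assms(1), of "\<lambda>_. 1 :: nat" f] by simp
  also have "\<dots> = card (f ` A) * h" using assms(2) by simp
  finally show ?thesis .
qed

text \<open>\<open>A\<close> is only required to be stable under translation by \<open>H\<close>,
  not to be a subgroup, so that the count also applies to the set of units.\<close>

lemma card_fibres_coset:
  fixes A :: "'a::ab_group_add set"
  assumes "finite A" and eq: "\<And>x y. x \<in> A \<Longrightarrow> y \<in> A \<Longrightarrow> f x = f y \<longleftrightarrow> y - x \<in> H"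
    and closed: "\<And>x h. x \<in> A \<Longrightarrow> h \<in> H \<Longrightarrow> x + h \<in> A"
  shows "card A = card (f ` A) * card H"
proof (rule card_fibres[OF assms(1)])
  fix y assume "y \<in> f ` A"
  then obtain x where x: "x \<in> A" "y = f x" by blast
  have "{z \<in> A. f z = y} = (\<lambda>h. x + h) ` H"
  proof (intro equalityI subsetI)
    fix z assume "z \<in> {z \<in> A. f z = y}"
    then have "z - x \<in> H" using eq[of x z] x by auto
    then show "z \<in> (\<lambda>h. x + h) ` H" by (rule rev_image_eqI) simp
  next
    fix z assume "z \<in> (\<lambda>h. x + h) ` H"
    then obtain h where h: "h \<in> H" "z = x + h" by blast
    then show "z \<in> {z \<in> A. f z = y}" using closed[OF x(1) h(1)] eq[of x z] x by simp
  qed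
  then show "card {z \<in> A. f z = y} = card H" by (simp add: card_image)
qed

lemma card_quot:
  fixes I :: "'a::{comm_ring_1,finite} set"
  assumes "is_ideal I"
  shows "card (UNIV :: 'a set) = card (quot I) * card I"
proof -
  have "y - x \<in> I \<longleftrightarrow> x - y \<in> I" for x y
  proof -
    have "c * z \<in> I" if "z \<in> I" for c z using assms that by (simp add: is_ideal_iff)
    from this[of "x - y" "-1"] this[of "y - x" "-1"] show ?thesis by auto
  qed
  then show ?thesis
    unfolding quot_def by (intro card_fibres_coset) (auto simp: coset_eq_iff[OF assms])
qed

section \<open>Units and powers of \<gamma>\<close>

locale finite_chain_ring =
  fixes \<gamma> :: "'a::{comm_ring_1,finite}"
  assumes chain: "chain_ring TYPE('a)" and maximal: "maximal_ideal (ideal_gen \<gamma>)"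
begin

abbreviation s :: nat where "s \<equiv> nilpotency_index \<gamma>"
abbreviation q :: nat where "q \<equiv> residue_size \<gamma>"
abbreviation socle :: "'a set" where "socle \<equiv> ideal_gen (\<gamma> ^ (s - 1))"

lemma dvd_total: "(a :: 'a) dvd b \<or> b dvd a"
proof -
  have "ideal_gen a \<subseteq> ideal_gen b \<or> ideal_gen b \<subseteq> ideal_gen a"
    using chain is_ideal_ideal_gen unfolding chain_ring_def by blast
  moreover have "a \<in> ideal_gen a" "b \<in> ideal_gen b" by (simp_all add: ideal_gen_def)
  ultimately have "a \<in> ideal_gen b \<or> b \<in> ideal_gen a" by blast
  then show ?thesis unfolding ideal_gen_def by blast
qed

text \<open>The ring is local: by comparability, a non-unit that is no multiple of \<gamma> would
  generate an ideal strictly above the maximal one and different from the ring.\<close>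

lemma not_unit_iff: "\<not> x dvd 1 \<longleftrightarrow> \<gamma> dvd x"
proof
  have n1: "\<not> \<gamma> dvd 1"
  proof
    assume "\<gamma> dvd 1"
    then have "\<gamma> dvd z" for z by (rule dvd_trans) simp
    then have "ideal_gen \<gamma> = UNIV" by (simp add: ideal_gen_def)
    then show False using maximal by (simp add: maximal_ideal_def)
  qed
  show "\<not> x dvd 1" if "\<gamma> dvd x" using that n1 dvd_trans by blast
  assume x: "\<not> x dvd 1"
  show "\<gamma> dvd x"
  proof (rule ccontr)
    assume "\<not> \<gamma> dvd x"
    then have "x dvd \<gamma>" using dvd_total by blast
    then have "ideal_gen \<gamma> \<subseteq> ideal_gen x" unfolding ideal_gen_def using dvd_trans by blast
    then have "ideal_gen x = ideal_gen \<gamma> \<or> ideal_gen x = UNIV"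
      using maximal is_ideal_ideal_gen unfolding maximal_ideal_def by blast
    moreover have "x \<in> ideal_gen x" by (simp add: ideal_gen_def)
    ultimately have "x \<in> ideal_gen \<gamma> \<or> 1 \<in> ideal_gen x" by auto
    then show False using x \<open>\<not> \<gamma> dvd x\<close> by (simp add: ideal_gen_def)
  qed
qed

lemma not_gamma_dvd_1: "\<not> \<gamma> dvd 1"
  using not_unit_iff[of 1] by simp

text \<open>Two powers coincide by finiteness, so
  \<open>\<gamma> ^ i * (1 - \<gamma> ^ (j - i)) = 0\<close> for some \<open>i < j\<close>; the
  second factor is 1 minus a multiple of \<gamma>, hence a unit.\<close>

lemma nilpotent: "\<exists>t>0. \<gamma> ^ t = 0"
proof -
  have "\<not> inj (\<lambda>t::nat. \<gamma> ^ t)"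
    using infinite_UNIV_nat finite_imageD[of "\<lambda>t::nat. \<gamma> ^ t" UNIV] by auto
  then obtain i j where "i < j" and eq: "\<gamma> ^ i = \<gamma> ^ j"
    unfolding inj_def by (metis linorder_neqE_nat)
  have "\<gamma> ^ j = \<gamma> ^ i * \<gamma> ^ (j - i)"
    using \<open>i < j\<close> by (simp flip: power_add)
  then have "\<gamma> ^ i * (1 - \<gamma> ^ (j - i)) = 0"
    using eq by (simp add: right_diff_distrib)
  moreover have "(1 - \<gamma> ^ (j - i)) dvd 1"
  proof (rule ccontr)
    assume "\<not> (1 - \<gamma> ^ (j - i)) dvd 1"
    then have "\<gamma> dvd 1 - \<gamma> ^ (j - i)" by (simp add: not_unit_iff)
    moreover have "\<gamma> dvd \<gamma> ^ (j - i)" using \<open>i < j\<close> by simp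
    ultimately have "\<gamma> dvd 1" using dvd_add[of \<gamma> "1 - \<gamma> ^ (j - i)" "\<gamma> ^ (j - i)"] by simp
    then show False using not_gamma_dvd_1 by simp
  qed
  then obtain c where "1 = (1 - \<gamma> ^ (j - i)) * c" by (rule dvdE)
  then have "\<gamma> ^ i = \<gamma> ^ i * (1 - \<gamma> ^ (j - i)) * c" by (simp add: mult.assoc)
  ultimately have "\<gamma> ^ i = 0" by simp
  \<comment> \<open>\<open>Suc i\<close> makes the exponent positive without excluding
    \<open>i = 0\<close> separately.\<close>
  then show ?thesis by (intro exI[of _ "Suc i"]) simp
qed

lemma s_pos: "0 < s" and gamma_pow_s: "\<gamma> ^ s = 0"
  unfolding nilpotency_index_def using LeastI_ex[OF nilpotent] by auto

lemma gamma_pow_eq_0_iff: "\<gamma> ^ i = 0 \<longleftrightarrow> s \<le> i"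
proof
  show "s \<le> i" if "\<gamma> ^ i = 0"
  proof (cases "i = 0")
    case False
    then show ?thesis unfolding nilpotency_index_def using that by (intro Least_le) simp
  qed (use that in simp)
  show "\<gamma> ^ i = 0" if "s \<le> i"
    using gamma_pow_s that by (metis le_imp_power_dvd dvd_0_left)
qed

text \<open>Take the largest power of \<gamma> dividing \<open>x\<close>. Exponents stay below
  \<open>s\<close> because \<open>x\<close> is nonzero, and a non-unit cofactor would allow one more
  factor \<gamma>.\<close>

lemma unit_decomp:
  assumes "x \<noteq> 0"
  obtains i u where "i < s" "u dvd 1" "x = u * \<gamma> ^ i"
proof -
  define i where "i = (GREATEST i. \<gamma> ^ i dvd x)"
  have bound: "j < s" if "\<gamma> ^ j dvd x" for j
    using that assms gamma_pow_eq_0_iff[of j] by (cases "j < s") auto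
  have i: "\<gamma> ^ i dvd x"
    unfolding i_def
    by (rule GreatestI_nat[of "\<lambda>i. \<gamma> ^ i dvd x" 0 s]) (simp, drule bound, simp)
  then obtain u where u: "x = \<gamma> ^ i * u" by (rule dvdE)
  have "u dvd 1"
  proof (rule ccontr)
    assume "\<not> u dvd 1"
    then have "\<gamma> ^ Suc i dvd x" by (simp add: not_unit_iff u mult.commute mult_dvd_mono)
    then have "Suc i \<le> i"
      unfolding i_def
      by (rule Greatest_le_nat[of "\<lambda>i. \<gamma> ^ i dvd x" _ s]) (drule bound, simp)
    then show False by simp
  qed
  then show thesis using that[of i u] u bound[OF i] by (simp add: mult.commute)
qed

lemma unit_mult_eq_0_iff: "u dvd 1 \<Longrightarrow> u * x = 0 \<longleftrightarrow> x = (0 :: 'a)"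
proof
  assume "u dvd 1" "u * x = 0"
  then obtain v where "1 = u * v" by (elim dvdE)
  have "v * (u * x) = (u * v) * x" by (simp only: ac_simps)
  then have "x = v * (u * x)" using \<open>1 = u * v\<close> by simp
  then show "x = 0" using \<open>u * x = 0\<close> by simp
qed simp

text \<open>The annihilator of \<open>\<gamma> ^ i\<close> is generated by the complementary power:
  writing \<open>x\<close> as a unit times \<open>\<gamma> ^ j\<close>, the product vanishes exactly
  if \<open>s \<le> i + j\<close>.\<close>

lemma gamma_pow_mult_eq_0_iff:
  assumes "i \<le> s"
  shows "\<gamma> ^ i * x = 0 \<longleftrightarrow> \<gamma> ^ (s - i) dvd x"
proof (cases "x = 0")
  case False
  then obtain j u where x: "j < s" "u dvd 1" "x = u * \<gamma> ^ j" by (rule unit_decomp)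
  have "\<gamma> ^ i * x = u * \<gamma> ^ (i + j)" using x by (simp add: power_add algebra_simps)
  then have *: "\<gamma> ^ i * x = 0 \<longleftrightarrow> s \<le> i + j"
    using unit_mult_eq_0_iff[OF x(2)] gamma_pow_eq_0_iff by simp
  show ?thesis
  proof
    assume "\<gamma> ^ i * x = 0"
    then show "\<gamma> ^ (s - i) dvd x" using * x by (simp add: le_imp_power_dvd)
  next
    assume "\<gamma> ^ (s - i) dvd x"
    then obtain c where "x = \<gamma> ^ (s - i) * c" by (rule dvdE)
    then have "\<gamma> ^ i * x = \<gamma> ^ (i + (s - i)) * c" by (simp add: power_add mult.assoc)
    then show "\<gamma> ^ i * x = 0" using assms gamma_pow_s by simp
  qed
qed simp

text \<open>Every nonzero ideal contains the socle: invert the unit part of \<open>x\<close> and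
  supply the missing powers of \<gamma>.\<close>

lemma mult_into_socle:
  assumes "x \<noteq> 0"
  obtains t where "t * x = \<gamma> ^ (s - 1)"
proof -
  obtain i u where x: "i < s" "u dvd 1" "x = u * \<gamma> ^ i" using assms by (rule unit_decomp)
  obtain v where v: "1 = u * v" using x(2) by (rule dvdE)
  have "(v * \<gamma> ^ (s - 1 - i)) * x = (u * v) * \<gamma> ^ (s - 1 - i + i)"
    by (simp add: x(3) power_add algebra_simps)
  then show thesis using that v x(1) by simp
qed

lemma gamma_socle: "\<gamma> * \<gamma> ^ (s - 1) = 0"
  using gamma_pow_s s_pos by (simp flip: power_Suc)

lemma socle_generator_nonzero: "\<gamma> ^ (s - 1) \<noteq> 0"
  using s_pos by (simp add: gamma_pow_eq_0_iff)

lemma nonunit_mult_socle: "\<not> u dvd 1 \<Longrightarrow> u * \<gamma> ^ (s - 1) = 0"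
proof -
  assume "\<not> u dvd 1"
  then obtain c where "u = \<gamma> * c" by (auto simp: not_unit_iff)
  then have "u * \<gamma> ^ (s - 1) = c * (\<gamma> * \<gamma> ^ (s - 1))" by (simp only: ac_simps)
  then show ?thesis by (simp only: gamma_socle mult_zero_right)
qed

section \<open>Cardinalities of ideals and of the unit group\<close>

lemma ideal_card_mult:
  assumes "is_ideal (I :: 'a set)" "{x. a * x = 0} \<subseteq> I"
  shows "card I = card ((*) a ` I) * card {x. a * x = 0}"
proof (rule card_fibres_coset)
  show "a * x = a * y \<longleftrightarrow> y - x \<in> {x. a * x = 0}" for x y by (auto simp: right_diff_distrib)
qed (use assms in \<open>auto simp: is_ideal_iff\<close>)

text \<open>Multiplication by \<gamma> maps each ideal of the chain onto the next one, with kernel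
  the socle, so consecutive cardinalities differ by the constant factor \<open>card socle\<close>,
  which equals \<open>q\<close>.\<close>

lemma card_ideal_gen: "i \<le> s \<Longrightarrow> card (ideal_gen (\<gamma> ^ i)) = q ^ (s - i)"
proof -
  have step: "card (ideal_gen (\<gamma> ^ i)) = card (ideal_gen (\<gamma> ^ Suc i)) * card socle" if "i < s" for i
  proof -
    have ker: "{x. \<gamma> * x = 0} = socle"
      using gamma_pow_mult_eq_0_iff[of 1] s_pos by (auto simp: ideal_gen_def)
    have image: "(*) \<gamma> ` ideal_gen (\<gamma> ^ i) = ideal_gen (\<gamma> ^ Suc i)"
      by (force simp: ideal_gen_def image_iff mult.assoc dvd_def)
    have sub: "socle \<subseteq> ideal_gen (\<gamma> ^ i)"
    proof -
      have "\<gamma> ^ i dvd \<gamma> ^ (s - 1)" using that by (intro le_imp_power_dvd) simp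
      then show ?thesis unfolding ideal_gen_def using dvd_trans by blast
    qed
    show ?thesis
      using ideal_card_mult[OF is_ideal_ideal_gen[of "\<gamma> ^ i"], of \<gamma>, unfolded ker, OF sub]
      by (simp only: image)
  qed
  \<comment> \<open>At the top of the chain the factor is also the index of the maximal ideal, that
    is, \<open>q\<close>.\<close>
  have "card socle = q"
    using step[of 0] card_quot[OF is_ideal_ideal_gen[of \<gamma>]] s_pos
    by (auto simp: residue_size_def ideal_gen_def)
  have pow: "j \<le> s \<Longrightarrow> card (ideal_gen (\<gamma> ^ (s - j))) = q ^ j" for j
  proof (induction j)
    case 0
    have "ideal_gen (0 :: 'a) = {0}" by (auto simp: ideal_gen_def)
    then show ?case using gamma_pow_s by simp
  next
    case (Suc j)
    then show ?case using step[of "s - Suc j"] \<open>card socle = q\<close> by (simp add: Suc_diff_Suc)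
  qed
  show "i \<le> s \<Longrightarrow> card (ideal_gen (\<gamma> ^ i)) = q ^ (s - i)" using pow[of "s - i"] by simp
qed

lemma card_socle: "card socle = q"
  using card_ideal_gen[of "s - 1"] s_pos by simp

lemma q_ge_2: "2 \<le> q"
proof -
  have "{0, \<gamma> ^ (s - 1)} \<subseteq> socle" by (auto simp: ideal_gen_def)
  then have "card {0, \<gamma> ^ (s - 1)} \<le> card socle" by (intro card_mono) auto
  then show ?thesis using socle_generator_nonzero card_socle by simp
qed

lemma card_units: "card {u :: 'a. u dvd 1} = (q - 1) * card (ideal_gen \<gamma>)"
proof -
  have "{u :: 'a. u dvd 1} = UNIV - ideal_gen \<gamma>" using not_unit_iff by (auto simp: ideal_gen_def)
  then have "card {u :: 'a. u dvd 1} = card (UNIV :: 'a set) - card (ideal_gen \<gamma>)" by (simp add: card_Diff_subset)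
  also have "card (UNIV :: 'a set) = q * card (ideal_gen \<gamma>)"
    using card_quot[OF is_ideal_ideal_gen[of \<gamma>]] by (simp add: residue_size_def)
  finally show ?thesis by (simp add: diff_mult_distrib)
qed

text \<open>By comparability one element is a multiple of the other, say \<open>b = a * c\<close>.
  If \<open>c\<close> were not a unit, a multiplier taking \<open>a\<close> to the generator of the
  socle would kill \<open>b\<close> but not \<open>a\<close>.\<close>

lemma annihilator_determines:
  assumes "\<And>t. t * a = 0 \<longleftrightarrow> t * b = (0 :: 'a)"
  obtains u where "u dvd 1" "b = u * a"
proof -
  have *: "\<exists>u. u dvd 1 \<and> b = u * a" if "a dvd b" and ann: "\<And>t. t * a = 0 \<longleftrightarrow> t * b = 0" for a b :: 'a
  proof (cases "a = 0")
    case True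
    then show ?thesis using that by (intro exI[of _ 1]) auto
  next
    case False
    obtain c where c: "b = a * c" using \<open>a dvd b\<close> by (rule dvdE)
    obtain t where t: "t * a = \<gamma> ^ (s - 1)" using False by (rule mult_into_socle)
    have "c dvd 1"
    proof (rule ccontr)
      assume "\<not> c dvd 1"
      then have "c * \<gamma> ^ (s - 1) = 0" by (rule nonunit_mult_socle)
      then have "t * b = 0" using t c by (metis mult.assoc mult.commute)
      then show False using ann t socle_generator_nonzero by metis
    qed
    then show ?thesis using c by (auto simp: mult.commute)
  qed
  show thesis
  proof (cases "a dvd b")
    case True
    then show ?thesis using *[OF _ assms] that by blast
  next
    \<comment> \<open>The roles of \<open>a\<close> and \<open>b\<close> are exchanged, and the
      resulting unit is inverted.\<close>
    case False
    then have "b dvd a" using dvd_total by blast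
    then obtain u where "u dvd 1" "a = u * b" using *[of b a] assms by auto
    moreover obtain w where "1 = u * w" using \<open>u dvd 1\<close> by (rule dvdE)
    ultimately have "b = w * a" "w dvd 1"
      by (metis mult.assoc mult.commute mult.left_neutral, metis \<open>1 = u * w\<close> dvd_triv_right)
    then show ?thesis using that by blast
  qed
qed

end

section \<open>Orthogonality of the homogeneous weight\<close>

lemma bij_betw_vec_PiE:
  "bij_betw (vec K) (\<Pi>\<^sub>E r\<in>{..<K}. A r) {v \<in> carrier_vec K. \<forall>r<K. v $ r \<in> A r}"
  by (rule bij_betw_byWitness[of _ "\<lambda>v. \<lambda>r\<in>{..<K}. v $ r"]) (auto simp: PiE_def extensional_def)

lemma finite_carrier_vec_finite: "finite (carrier_vec K :: 'a::finite vec set)"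
  using bij_betw_finite[OF bij_betw_vec_PiE[of K "\<lambda>_. UNIV :: 'a set"]] by (simp add: finite_PiE)

lemma card_vec_product:
  "card {v \<in> carrier_vec K. \<forall>r<K. v $ r \<in> A r} = (\<Prod>r<K. card (A r))"
  using bij_betw_same_card[OF bij_betw_vec_PiE[of K A]] by (simp add: card_PiE)

lemma mem_unit_orbit_self: "v \<in> unit_orbit v" for v :: "'a::comm_ring_1 vec"
  unfolding unit_orbit_def by (rule CollectI, rule exI[of _ 1]) simp

lemma unit_orbit_cong:
  fixes v :: "'a::comm_ring_1 vec"
  assumes "w \<in> unit_orbit v"
  shows "unit_orbit w = unit_orbit v"
proof -
  have sub: "unit_orbit w \<subseteq> unit_orbit v" if "w \<in> unit_orbit v" for v w :: "'a vec"
  proof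
    fix z assume "z \<in> unit_orbit w"
    then obtain u u' where "u dvd 1" "u' dvd 1" "z = u \<cdot>\<^sub>v (u' \<cdot>\<^sub>v v)"
      using \<open>w \<in> unit_orbit v\<close> by (auto simp: unit_orbit_def)
    then show "z \<in> unit_orbit v"
      unfolding unit_orbit_def using mult_dvd_mono[of u 1 u' 1]
      by (intro CollectI exI[of _ "u * u'"]) (simp add: smult_smult_assoc)
  qed
  obtain u where u: "u dvd 1" "w = u \<cdot>\<^sub>v v" using assms by (auto simp: unit_orbit_def)
  obtain u' where u': "1 = u * u'" using u(1) by (rule dvdE)
  have "v = u' \<cdot>\<^sub>v w" using u' by (simp add: u(2) smult_smult_assoc mult.commute[of u'])
  moreover have "u' dvd 1" unfolding u' by simp
  ultimately have "v \<in> unit_orbit w" by (auto simp: unit_orbit_def)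
  then show ?thesis using sub assms by blast
qed

lemma unit_orbit_zero: "unit_orbit (0\<^sub>v K) = {0\<^sub>v K :: 'a::comm_ring_1 vec}"
  unfolding unit_orbit_def by (auto intro: exI[of _ 1])

lemma mem_unit_orbit_zero_iff:
  "0\<^sub>v K \<in> unit_orbit v \<longleftrightarrow> v = (0\<^sub>v K :: 'a::comm_ring_1 vec)"
  using unit_orbit_cong[of "0\<^sub>v K" v] unit_orbit_zero[of K] mem_unit_orbit_self[of v] by auto

section \<open>Cancellation in sums of weights\<close>

context finite_chain_ring
begin

text \<open>The average over the units \<open>u\<close> of \<open>\<chi> (u a)\<close>, for a generating character \<open>\<chi>\<close> of the
  ring.\<close>

definition cowt :: "'a \<Rightarrow> real" where "cowt a = 1 - wt_elem \<gamma> a"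

lemma wt_elem_0 [simp]: "wt_elem \<gamma> 0 = 0"
  by (simp add: wt_elem_def)

lemma cowt_0 [simp]: "cowt 0 = 1"
  by (simp add: cowt_def)

lemma wt_elem_pos: "a \<noteq> 0 \<Longrightarrow> 0 < wt_elem \<gamma> a"
  using q_ge_2 by (simp add: wt_elem_def)

lemma wt_elem_nonneg: "0 \<le> wt_elem \<gamma> a"
  using wt_elem_pos[of a] by (cases "a = 0") auto

lemma wt_elem_unit_mult:
  assumes "u dvd 1"
  shows "wt_elem \<gamma> (u * a) = wt_elem \<gamma> a"
proof -
  obtain v where v: "1 = u * v" using assms by (rule dvdE)
  have "u * a \<in> socle \<longleftrightarrow> a \<in> socle"
  proof
    assume "u * a \<in> socle"
    then have "\<gamma> ^ (s - 1) dvd v * (u * a)" by (simp add: ideal_gen_def)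
    also have "v * (u * a) = (u * v) * a" by (simp only: ac_simps)
    finally show "a \<in> socle" using v by (simp add: ideal_gen_def)
  qed (simp add: ideal_gen_def)
  then show ?thesis using unit_mult_eq_0_iff[OF assms] by (simp add: wt_elem_def)
qed

text \<open>On the socle, \<open>cowt\<close> is 1 at zero and \<open>-1 / (q - 1)\<close> at the
  other \<open>q - 1\<close> elements, which cancels; outside the socle the weight is 1 and
  \<open>cowt\<close> vanishes.\<close>

lemma sum_cowt_coset: "(\<Sum>t\<in>socle. cowt (b + t)) = 0"
proof (cases "b \<in> socle")
  case True
  have "(\<Sum>t\<in>socle. cowt (b + t)) = (\<Sum>t\<in>socle. cowt t)"
    using True by (intro sum.reindex_bij_witness[of _ "\<lambda>t. t - b" "\<lambda>t. b + t"]) (auto simp: ideal_gen_def)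
  also have "\<dots> = cowt 0 + (\<Sum>t\<in>socle - {0}. cowt t)"
    by (rule sum.remove) (auto simp: ideal_gen_def)
  also have "(\<Sum>t\<in>socle - {0}. cowt t) = (\<Sum>t\<in>socle - {0}. 1 - real q / (real q - 1))"
    by (intro sum.cong) (auto simp: cowt_def wt_elem_def)
  also have "\<dots> = (real q - 1) * (1 - real q / (real q - 1))"
    using card_socle q_ge_2 by (simp add: ideal_gen_def)
  also have "cowt 0 + \<dots> = 0"
    using q_ge_2 by (simp add: field_simps)
  finally show ?thesis .
next
  case False
  have "cowt (b + t) = 0" if "t \<in> socle" for t
  proof -
    have "b + t \<notin> socle"
      using False that dvd_diff[of "\<gamma> ^ (s - 1)" "b + t" t] by (auto simp: ideal_gen_def)
    moreover have "b + t \<noteq> 0"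
      using \<open>b + t \<notin> socle\<close> by (auto simp: ideal_gen_def)
    ultimately show ?thesis by (simp add: cowt_def wt_elem_def)
  qed
  then show ?thesis by simp
qed

text \<open>Translating along a multiple of \<open>x0\<close> moves \<open>v \<bullet> x\<close> uniformly through a coset of the
  socle, on which \<open>cowt\<close> averages to \<open>0\<close>.\<close>

lemma sum_cowt_eq_0:
  fixes a :: "'a vec \<Rightarrow> real"
  assumes X: "X \<subseteq> carrier_vec K" "\<And>x r. x \<in> X \<Longrightarrow> x + r \<cdot>\<^sub>v x0 \<in> X"
    and v: "v \<in> carrier_vec K" "x0 \<in> carrier_vec K" "v \<bullet> x0 \<noteq> 0"
    and a: "\<And>x r. x \<in> X \<Longrightarrow> a (x + r \<cdot>\<^sub>v x0) = a x"
  shows "(\<Sum>x\<in>X. a x * cowt (v \<bullet> x)) = 0"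
proof -
  \<comment> \<open>With this \<open>t\<close>, the translations along
    \<open>(r * t) \<cdot>\<^sub>v x0\<close> change \<open>v \<bullet> x\<close> by every element
    of the socle as \<open>r\<close> varies.\<close>
  obtain t where t: "t * (v \<bullet> x0) = \<gamma> ^ (s - 1)" using v(3) by (rule mult_into_socle)
  have shift: "(\<Sum>x\<in>X. a x * cowt (v \<bullet> x)) = (\<Sum>x\<in>X. a x * cowt (v \<bullet> x + b))" if socle: "b \<in> socle" for b
  proof -
    obtain r where b: "b = \<gamma> ^ (s - 1) * r" using socle unfolding ideal_gen_def by blast
    have b': "b = (r * t) * (v \<bullet> x0)" unfolding b t[symmetric] by (simp add: ac_simps)
    have inv: "x + c \<cdot>\<^sub>v x0 + (- c) \<cdot>\<^sub>v x0 = x" if "x \<in> X" for x c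
      using that X(1) v(2) by (intro eq_vecI) (auto simp: subset_iff)
    have inv': "x + (- c) \<cdot>\<^sub>v x0 + c \<cdot>\<^sub>v x0 = x" if "x \<in> X" for x c
      using inv[OF that, of "- c"] by simp
    show ?thesis
    proof (rule sum.reindex_bij_witness[of _ "\<lambda>x. x + (r * t) \<cdot>\<^sub>v x0" "\<lambda>x. x + (- (r * t)) \<cdot>\<^sub>v x0"])
      fix x assume x: "x \<in> X"
      have *: "v \<bullet> (x + (- (r * t)) \<cdot>\<^sub>v x0) + b = v \<bullet> x"
        using x X(1) v by (auto simp: scalar_prod_add_distrib[of _ K] b' subset_iff)
      show "a (x + (- (r * t)) \<cdot>\<^sub>v x0) * cowt (v \<bullet> (x + (- (r * t)) \<cdot>\<^sub>v x0) + b) = a x * cowt (v \<bullet> x)"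
        using a[OF x] * by simp
    qed (use inv inv' X(2) in auto)
  qed
  \<comment> \<open>The sum is unchanged by a shift by any \<open>b\<close> in the socle, so it can
    be replaced by its average over all shifts, where the inner sum over \<open>b\<close> is
    0.\<close>
  have "real q * (\<Sum>x\<in>X. a x * cowt (v \<bullet> x)) = (\<Sum>b\<in>socle. \<Sum>x\<in>X. a x * cowt (v \<bullet> x))"
    by (simp add: card_socle del: One_nat_def)
  also have "\<dots> = (\<Sum>b\<in>socle. \<Sum>x\<in>X. a x * cowt (v \<bullet> x + b))"
    by (rule sum.cong[OF refl]) (rule shift)
  also have "\<dots> = (\<Sum>x\<in>X. a x * (\<Sum>b\<in>socle. cowt (v \<bullet> x + b)))"
    by (subst sum.swap) (simp add: sum_distrib_left)
  also have "\<dots> = 0" by (simp add: sum_cowt_coset del: One_nat_def)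
  finally show ?thesis using q_ge_2 by simp
qed

lemma sum_cowt_carrier:
  assumes "v \<in> carrier_vec K" "v \<noteq> 0\<^sub>v K"
  shows "(\<Sum>x\<in>carrier_vec K. cowt (v \<bullet> x)) = 0"
proof -
  \<comment> \<open>A nonzero coordinate of \<open>v\<close> gives a unit vector that
    \<open>v\<close> does not kill, the direction of translation.\<close>
  obtain r where "r < K" "v $ r \<noteq> 0"
    using assms by (metis carrier_vecD eq_vecI index_zero_vec)
  then show ?thesis
    using sum_cowt_eq_0[of "carrier_vec K" K "unit_vec K r" v "\<lambda>_. 1"] assms(1) by simp
qed

text \<open>Some coordinate of \<open>v\<close> divides all others. There the annihilators of
  \<open>v\<close> and \<open>v'\<close> agree, which yields the unit \<open>u\<close>; the kernel
  then carries the relations between the coordinates of \<open>v\<close> over to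
  \<open>v'\<close>.\<close>

lemma same_kernel_imp_orbit:
  assumes v: "v \<in> carrier_vec K" "v' \<in> carrier_vec K"
    and ker: "\<And>x. x \<in> carrier_vec K \<Longrightarrow> v \<bullet> x = 0 \<longleftrightarrow> v' \<bullet> x = (0 :: 'a)"
  shows "v' \<in> unit_orbit v"
proof (cases "K = 0")
  case True
  then have "v' = v" using v by (intro eq_vecI) auto
  then show ?thesis by (simp add: mem_unit_orbit_self)
next
  case False
  \<comment> \<open>Divisibility is total, so a coordinate dividing all of an initial segment
    survives or is replaced when the segment grows by one.\<close>
  have "\<exists>r<K. \<forall>i<m. v $ r dvd v $ i" if "m \<le> K" for m
    using that
  proof (induction m)
    case 0
    then show ?case using False by auto
  next
    case (Suc m)
    then obtain r where r: "r < K" "\<forall>i<m. v $ r dvd v $ i" by auto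
    then show ?case
      using dvd_total[of "v $ r" "v $ m"] Suc.prems less_Suc_eq dvd_trans
      by (metis Suc_le_lessD dvd_refl)
  qed
  then obtain r where r: "r < K" "\<And>i. i < K \<Longrightarrow> v $ r dvd v $ i" by blast
  have "t * v $ r = 0 \<longleftrightarrow> t * v' $ r = 0" for t
    using ker[of "t \<cdot>\<^sub>v unit_vec K r"] r(1) v by auto
  then obtain u where u: "u dvd 1" "v' $ r = u * v $ r" using annihilator_determines by metis
  have "v' $ i = u * v $ i" if i: "i < K" for i
  proof -
    obtain c where c: "v $ i = v $ r * c" using r(2)[OF i] by (rule dvdE)
    \<comment> \<open>This vector encodes the relation \<open>v $ i = c * v $ r\<close>; since
      \<open>v\<close> kills it, so does \<open>v'\<close>.\<close>
    let ?x = "unit_vec K i + (- c) \<cdot>\<^sub>v unit_vec K r"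
    have *: "w \<bullet> ?x = w $ i - c * w $ r" if "w \<in> carrier_vec K" for w
      using that i r(1) by (auto simp: scalar_prod_add_distrib[of _ K])
    have "v' \<bullet> ?x = 0" using ker[of ?x] *[OF v(1)] c by (simp add: mult.commute)
    then show ?thesis using *[OF v(2)] c u(2) by (simp add: ac_simps)
  qed
  then have "v' = u \<cdot>\<^sub>v v" using v by (intro eq_vecI) auto
  then show ?thesis using u(1) by (auto simp: unit_orbit_def)
qed

lemma cowt_orthogonal:
  assumes v: "v \<in> carrier_vec K" "v' \<in> carrier_vec K" and "v' \<notin> unit_orbit v"
  shows "(\<Sum>x\<in>carrier_vec K. cowt (v \<bullet> x) * cowt (v' \<bullet> x)) = 0"
proof -
  \<comment> \<open>The factor \<open>cowt (v \<bullet> x)\<close> is invariant under translation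
    along \<open>x0\<close> and serves as the coefficient \<open>a\<close> of
    \<open>sum_cowt_eq_0\<close>.\<close>
  have *: "(\<Sum>x\<in>carrier_vec K. cowt (v \<bullet> x) * cowt (v' \<bullet> x)) = 0"
    if "v \<in> carrier_vec K" "v' \<in> carrier_vec K" "x0 \<in> carrier_vec K" "v \<bullet> x0 = 0" "v' \<bullet> x0 \<noteq> 0"
    for v v' x0
    using that by (intro sum_cowt_eq_0[of "carrier_vec K" K x0]) (auto simp: scalar_prod_add_distrib[of _ K])
  obtain x0 where x0: "x0 \<in> carrier_vec K" "(v \<bullet> x0 = 0) \<noteq> (v' \<bullet> x0 = 0)"
    using same_kernel_imp_orbit[OF v] assms(3) by blast
  show ?thesis
  proof (cases "v \<bullet> x0 = 0")
    case True
    then show ?thesis using *[OF v x0(1)] x0(2) by simp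
  next
    case False
    then have "(\<Sum>x\<in>carrier_vec K. cowt (v' \<bullet> x) * cowt (v \<bullet> x)) = 0"
      using *[OF v(2,1) x0(1)] x0(2) by simp
    then show ?thesis by (simp add: mult.commute)
  qed
qed

lemma wt_elem_orbit:
  assumes "v' \<in> unit_orbit v" "v \<in> carrier_vec K" "x \<in> carrier_vec K"
  shows "wt_elem \<gamma> (v' \<bullet> x) = wt_elem \<gamma> (v \<bullet> x)"
  using assms by (auto simp: unit_orbit_def wt_elem_unit_mult)

text \<open>Orthogonality removes the columns outside the orbit of \<open>v\<close>; those inside
  have the same \<open>cowt\<close> as \<open>v\<close>, so each contributes the squared
  norm.\<close>

lemma sum_cowt_columns:
  assumes J: "finite J" "\<And>j. j \<in> J \<Longrightarrow> h j \<in> carrier_vec K" and v: "v \<in> carrier_vec K"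
  shows "(\<Sum>x\<in>carrier_vec K. (\<Sum>j\<in>J. cowt (h j \<bullet> x)) * cowt (v \<bullet> x)) =
    real (card {j \<in> J. h j \<in> unit_orbit v}) * (\<Sum>x\<in>carrier_vec K. (cowt (v \<bullet> x))\<^sup>2)"
    (is "_ = _ * ?c")
proof -
  have "(\<Sum>x\<in>carrier_vec K. (\<Sum>j\<in>J. cowt (h j \<bullet> x)) * cowt (v \<bullet> x)) =
    (\<Sum>j\<in>J. \<Sum>x\<in>carrier_vec K. cowt (v \<bullet> x) * cowt (h j \<bullet> x))"
    by (subst sum.swap) (simp add: sum_distrib_left mult.commute)
  also have "\<dots> = (\<Sum>j\<in>J. if h j \<in> unit_orbit v then ?c else 0)"
  proof (rule sum.cong[OF refl])
    fix j assume j: "j \<in> J"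
    show "(\<Sum>x\<in>carrier_vec K. cowt (v \<bullet> x) * cowt (h j \<bullet> x)) = (if h j \<in> unit_orbit v then ?c else 0)"
      using cowt_orthogonal[OF v J(2)[OF j]] wt_elem_orbit[of "h j" v K] v
      by (auto simp: cowt_def power2_eq_square intro!: sum.cong)
  qed
  also have "\<dots> = real (card {j \<in> J. h j \<in> unit_orbit v}) * ?c"
    using J(1) by (simp add: sum.If_cases Int_def)
  finally show ?thesis .
qed

text \<open>The units and the maximal ideal are both unions of cosets of the annihilator of
  \<open>v\<close>, so \<open>r \<mapsto> r \<cdot>\<^sub>v v\<close> has fibres of the same size on
  both, and there are \<open>q - 1\<close> times as many units. In particular \<open>q - 1\<close>
  divides the size of the orbit.\<close>

lemma card_unit_orbit:
  assumes v: "v \<in> carrier_vec K" "v \<noteq> 0\<^sub>v K"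
  shows "card (unit_orbit v) = (q - 1) * card ((\<lambda>r. r \<cdot>\<^sub>v v) ` ideal_gen \<gamma>)"
proof -
  let ?H = "{r. r \<cdot>\<^sub>v v = 0\<^sub>v K}"
  have eq: "a \<cdot>\<^sub>v v = b \<cdot>\<^sub>v v \<longleftrightarrow> b - a \<in> ?H" for a b
    using v(1) by (auto simp: vec_eq_iff algebra_simps)
  \<comment> \<open>A unit cannot kill a nonzero coordinate of \<open>v\<close>.\<close>
  have sub: "?H \<subseteq> ideal_gen \<gamma>"
  proof
    fix r assume "r \<in> ?H"
    then have "r * v $ i = 0" if "i < K" for i
      using v(1) that by (auto simp: vec_eq_iff)
    moreover obtain i where "i < K" "v $ i \<noteq> 0"
      using v by (metis carrier_vecD eq_vecI index_zero_vec)
    ultimately have "\<not> r dvd 1" using unit_mult_eq_0_iff by blast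
    then show "r \<in> ideal_gen \<gamma>" by (simp add: not_unit_iff ideal_gen_def)
  qed
  have "card {u :: 'a. u dvd 1} = card ((\<lambda>r. r \<cdot>\<^sub>v v) ` {u. u dvd 1}) * card ?H"
  proof (rule card_fibres_coset)
    fix u h assume u: "u \<in> {u :: 'a. u dvd 1}" and "h \<in> ?H"
    then have "\<gamma> dvd h" using sub by (auto simp: ideal_gen_def)
    moreover have "\<not> \<gamma> dvd u" using u not_unit_iff by auto
    ultimately have "\<not> \<gamma> dvd u + h" using dvd_add_left_iff by blast
    then show "u + h \<in> {u. u dvd 1}" using not_unit_iff by blast
  qed (use eq in auto)
  moreover have "(\<lambda>r. r \<cdot>\<^sub>v v) ` {u. u dvd 1} = unit_orbit v"
    by (auto simp: unit_orbit_def)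
  moreover have "card (ideal_gen \<gamma>) = card ((\<lambda>r. r \<cdot>\<^sub>v v) ` ideal_gen \<gamma>) * card ?H"
    by (rule card_fibres_coset) (use eq sub in \<open>auto simp: ideal_gen_def\<close>)
  ultimately have "card (unit_orbit v) * card ?H =
      (q - 1) * card ((\<lambda>r. r \<cdot>\<^sub>v v) ` ideal_gen \<gamma>) * card ?H"
    using card_units by (simp only: mult.assoc)
  moreover have "0 \<in> ?H" using v(1) by auto
  then have "card ?H > 0" by (simp add: card_gt_0_iff) blast
  ultimately show ?thesis by (simp only: mult_cancel2 neq0_conv[symmetric]) blast
qed

end

section \<open>Columns of constant weight codes\<close>

lemma finite_unit_orbit: "finite (unit_orbit (v :: 'a::{comm_ring_1,finite} vec))"
  unfolding unit_orbit_def by simp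

lemma unit_orbit_eq_iff: "unit_orbit w = unit_orbit v \<longleftrightarrow> w \<in> unit_orbit (v :: 'a::comm_ring_1 vec)"
  using unit_orbit_cong mem_unit_orbit_self by blast

lemma mem_unit_orbit_sym: "w \<in> unit_orbit v \<longleftrightarrow> v \<in> unit_orbit (w :: 'a::comm_ring_1 vec)"
  using unit_orbit_eq_iff[of v w] unit_orbit_eq_iff[of w v] by auto

text \<open>Coordinate \<open>r\<close> of a column lies in the ideal generated by \<open>\<gamma> ^ lev r\<close>; the row
  combinations \<open>x \<in> relations\<close> are those annihilated by all such columns.\<close>

locale leveled_chain_ring = finite_chain_ring +
  fixes K :: nat and lev :: "nat \<Rightarrow> nat"
  assumes lev_less: "r < K \<Longrightarrow> lev r < s"
begin

definition columns :: "'a vec set" where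
  "columns = {v \<in> carrier_vec K. \<forall>r<K. v $ r \<in> ideal_gen (\<gamma> ^ lev r)}"

definition relations :: "'a vec set" where
  "relations = {x \<in> carrier_vec K. \<forall>r<K. x $ r \<in> ideal_gen (\<gamma> ^ (s - lev r))}"

lemma columns_carrier: "v \<in> columns \<Longrightarrow> v \<in> carrier_vec K"
  by (simp add: columns_def)

lemma finite_columns: "finite columns"
  using finite_carrier_vec_finite[of K] by (rule rev_finite_subset) (auto simp: columns_def)

lemma zero_columns: "0\<^sub>v K \<in> columns"
  by (simp add: columns_def ideal_gen_def)

lemma unit_orbit_columns: "v \<in> columns \<Longrightarrow> unit_orbit v \<subseteq> columns"
  by (auto simp: columns_def unit_orbit_def ideal_gen_def)

lemma card_columns: "card columns = (\<Prod>r<K. q ^ (s - lev r))"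
  unfolding columns_def card_vec_product using lev_less
  by (intro prod.cong) (auto intro!: card_ideal_gen less_imp_le)

lemma relations_annihilate:
  assumes "v \<in> columns" "x \<in> relations"
  shows "v \<bullet> x = 0"
  unfolding scalar_prod_def
proof (rule sum.neutral, rule ballI)
  fix r assume "r \<in> {0..<dim_vec x}"
  then have r: "r < K" using assms(2) by (auto simp: relations_def)
  obtain a where a: "v $ r = \<gamma> ^ lev r * a"
    using assms(1) r by (auto simp: columns_def ideal_gen_def)
  obtain b where b: "x $ r = \<gamma> ^ (s - lev r) * b"
    using assms(2) r by (auto simp: relations_def ideal_gen_def)
  have "v $ r * x $ r = \<gamma> ^ (lev r + (s - lev r)) * (a * b)"
    by (simp add: a b power_add ac_simps)
  then show "v $ r * x $ r = 0" using lev_less[OF r] gamma_pow_s by simp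
qed

text \<open>Together with \<open>relations_annihilate\<close> this makes \<open>relations\<close>
  the exact annihilator of \<open>columns\<close>: a multiple of one unit vector tests one
  coordinate.\<close>

lemma not_relation:
  assumes "x \<in> carrier_vec K" "x \<notin> relations"
  obtains v where "v \<in> columns" "v \<bullet> x \<noteq> 0"
proof -
  obtain r where r: "r < K" "\<not> \<gamma> ^ (s - lev r) dvd x $ r"
    using assms by (auto simp: relations_def ideal_gen_def)
  let ?v = "\<gamma> ^ lev r \<cdot>\<^sub>v unit_vec K r"
  have "?v \<bullet> x = \<gamma> ^ lev r * x $ r" using r(1) assms(1) by simp
  moreover have "\<gamma> ^ lev r * x $ r \<noteq> 0"
    using r lev_less by (simp add: gamma_pow_mult_eq_0_iff less_imp_le)
  moreover have "?v \<in> columns"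
    using r(1) by (auto simp: columns_def ideal_gen_def)
  ultimately show thesis using that by metis
qed

text \<open>The code with all of \<open>columns\<close> as its columns has constant weight. Here
  \<open>x\<close> is the fixed functional and the sum runs over the submodule
  \<open>columns\<close>, which contains a direction \<open>v\<close> not killed by
  \<open>x\<close>.\<close>

lemma sum_wt_columns:
  assumes x: "x \<in> carrier_vec K" "x \<notin> relations"
  shows "(\<Sum>v\<in>columns. wt_elem \<gamma> (v \<bullet> x)) = real (card columns)"
proof -
  obtain v where v: "v \<in> columns" "v \<bullet> x \<noteq> 0" using x by (rule not_relation)
  have "(\<Sum>w\<in>columns. 1 * cowt (x \<bullet> w)) = 0"
  proof (rule sum_cowt_eq_0[of columns K v x "\<lambda>_. 1"])
    show "w + r \<cdot>\<^sub>v v \<in> columns" if "w \<in> columns" for w r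
      using that v(1) by (auto simp: columns_def ideal_gen_def)
    show "x \<bullet> v \<noteq> 0" using v x(1) columns_carrier comm_scalar_prod by metis
  qed (use x v columns_carrier in auto)
  moreover have "x \<bullet> w = w \<bullet> x" if "w \<in> columns" for w
    using comm_scalar_prod[OF x(1) columns_carrier[OF that]] .
  ultimately have "(\<Sum>w\<in>columns. cowt (w \<bullet> x)) = 0" by simp
  then show ?thesis by (simp add: cowt_def sum_subtractf)
qed

text \<open>Both sides evaluate the pairing of the sum of all \<open>cowt (h j \<bullet> x)\<close>
  with \<open>cowt (v \<bullet> x)\<close>: the left by orthogonality, the right because constant
  weight makes the first function a constant plus \<open>w\<close> times the indicator of
  \<open>relations\<close>.\<close>

lemma card_orbit_columns:
  assumes J: "finite J" "\<And>j. j \<in> J \<Longrightarrow> h j \<in> columns"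
    and w: "\<And>x. x \<in> carrier_vec K - relations \<Longrightarrow> (\<Sum>j\<in>J. wt_elem \<gamma> (h j \<bullet> x)) = w"
    and v: "v \<in> columns" "v \<noteq> 0\<^sub>v K"
  shows "real (card {j \<in> J. h j \<in> unit_orbit v}) * (\<Sum>x\<in>carrier_vec K. (cowt (v \<bullet> x))\<^sup>2)
    = w * real (card relations)"
proof -
  have vK: "v \<in> carrier_vec K" using v(1) by (rule columns_carrier)
  have fin: "finite (carrier_vec K :: 'a vec set)" by (rule finite_carrier_vec_finite)
  have rel: "relations \<subseteq> carrier_vec K" by (auto simp: relations_def)
  have inner: "(\<Sum>j\<in>J. cowt (h j \<bullet> x)) = (real (card J) - w) + (if x \<in> relations then w else 0)"
    if "x \<in> carrier_vec K" for x
  proof -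
    have "(\<Sum>j\<in>J. cowt (h j \<bullet> x)) = real (card J) - (\<Sum>j\<in>J. wt_elem \<gamma> (h j \<bullet> x))"
      by (simp add: cowt_def sum_subtractf)
    moreover have "(\<Sum>j\<in>J. wt_elem \<gamma> (h j \<bullet> x)) = 0" if "x \<in> relations"
      using relations_annihilate[OF J(2) that] by (intro sum.neutral) auto
    ultimately show ?thesis using w[of x] that by auto
  qed
  have "(\<Sum>x\<in>carrier_vec K. (\<Sum>j\<in>J. cowt (h j \<bullet> x)) * cowt (v \<bullet> x)) =
    (\<Sum>x\<in>carrier_vec K. (real (card J) - w) * cowt (v \<bullet> x) + (if x \<in> relations then w * cowt (v \<bullet> x) else 0))"
    by (intro sum.cong) (auto simp: inner algebra_simps)
  also have "\<dots> = (real (card J) - w) * (\<Sum>x\<in>carrier_vec K. cowt (v \<bullet> x)) + (\<Sum>x\<in>relations. w * cowt (v \<bullet> x))"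
    using rel fin by (simp add: sum.distrib sum_distrib_left sum.If_cases Int_absorb1)
  \<comment> \<open>\<open>v\<close> kills every relation, so \<open>cowt\<close> is 1
    there.\<close>
  also have "(\<Sum>x\<in>relations. w * cowt (v \<bullet> x)) = (\<Sum>x\<in>relations. w)"
    using relations_annihilate[OF v(1)] by (intro sum.cong) auto
  finally show ?thesis
    using sum_cowt_columns[OF J(1) columns_carrier[OF J(2)] vK] sum_cowt_carrier[OF vK v(2)]
    by simp
qed

text \<open>The same identity for the family of all columns has weight \<open>card columns\<close>
  and multiplicity \<open>card (unit_orbit v)\<close>; comparing the two eliminates the norm and
  \<open>card relations\<close>.\<close>

lemma orbit_multiplicity:
  assumes J: "finite J" "\<And>j. j \<in> J \<Longrightarrow> h j \<in> columns"
    and w: "\<And>x. x \<in> carrier_vec K - relations \<Longrightarrow> (\<Sum>j\<in>J. wt_elem \<gamma> (h j \<bullet> x)) = w"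
    and v: "v \<in> columns - {0\<^sub>v K}"
  shows "real (card {j \<in> J. h j \<in> unit_orbit v}) = w / real (card columns) * real (card (unit_orbit v))"
proof -
  let ?c = "\<Sum>x\<in>carrier_vec K. (cowt (v \<bullet> x))\<^sup>2"
  have v': "v \<in> columns" "v \<noteq> 0\<^sub>v K" using v by auto
  \<comment> \<open>The term at the zero vector is 1, so the norm is positive and can be
    cancelled.\<close>
  have "(cowt (v \<bullet> 0\<^sub>v K))\<^sup>2 \<le> ?c"
    by (rule member_le_sum) (auto simp: finite_carrier_vec_finite)
  then have c: "?c > 0" using columns_carrier[OF v'(1)] by simp
  have eq: "real (card {j \<in> J. h j \<in> unit_orbit v}) * ?c = w * real (card relations)"
    by (rule card_orbit_columns[OF J w v'])
  have "{j \<in> columns. j \<in> unit_orbit v} = unit_orbit v"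
    using unit_orbit_columns[OF v'(1)] by auto
  then have eq': "real (card (unit_orbit v)) * ?c = real (card columns) * real (card relations)"
    using card_orbit_columns[of columns "\<lambda>v. v" "real (card columns)" v] finite_columns sum_wt_columns v'
    by simp
  have "real (card {j \<in> J. h j \<in> unit_orbit v}) * real (card columns) * ?c
      = w * real (card relations) * real (card columns)"
    using eq by (simp add: ac_simps)
  also have "\<dots> = w * real (card (unit_orbit v)) * ?c"
    using eq' by (simp add: ac_simps)
  finally have "real (card {j \<in> J. h j \<in> unit_orbit v}) * real (card columns) = w * real (card (unit_orbit v))"
    using c by simp
  moreover have "card columns > 0" using finite_columns zero_columns by (auto simp: card_gt_0_iff)
  ultimately show ?thesis by (simp add: field_simps)
qed

text \<open>Each value \<open>F (h j)\<close> is spread evenly over the orbit of \<open>h j\<close>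
  and the sums are exchanged. The multiplicity of the zero vector is unconstrained, hence the
  condition \<open>F (0\<^sub>v K) = 0\<close>.\<close>

lemma sum_over_columns:
  fixes F :: "'a vec \<Rightarrow> real"
  assumes J: "finite J" "\<And>j. j \<in> J \<Longrightarrow> h j \<in> columns"
    and mult: "\<And>v. v \<in> columns - {0\<^sub>v K} \<Longrightarrow>
      real (card {j \<in> J. h j \<in> unit_orbit v}) = a * real (card (unit_orbit v))"
    and F: "F (0\<^sub>v K) = 0" "\<And>v w. v \<in> columns \<Longrightarrow> w \<in> unit_orbit v \<Longrightarrow> F w = F v"
  shows "(\<Sum>j\<in>J. F (h j)) = a * (\<Sum>v\<in>columns. F v)"
proof -
  have pos: "card (unit_orbit v) > 0" for v :: "'a vec"
    using finite_unit_orbit[of v] mem_unit_orbit_self[of v] by (auto simp: card_gt_0_iff)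
  have "(\<Sum>j\<in>J. F (h j)) = (\<Sum>j\<in>J. \<Sum>v\<in>columns. if h j \<in> unit_orbit v then F v / card (unit_orbit v) else 0)"
  proof (rule sum.cong[OF refl])
    fix j assume j: "j \<in> J"
    have "{v \<in> columns. h j \<in> unit_orbit v} = unit_orbit (h j)"
      using unit_orbit_columns[OF J(2)[OF j]] mem_unit_orbit_sym by blast
    then have "(\<Sum>v\<in>columns. if h j \<in> unit_orbit v then F v / card (unit_orbit v) else 0)
      = (\<Sum>v\<in>unit_orbit (h j). F v / card (unit_orbit v))"
      using finite_columns by (simp add: sum.If_cases Int_def)
    also have "\<dots> = (\<Sum>v\<in>unit_orbit (h j). F (h j) / card (unit_orbit (h j)))"
      by (intro sum.cong refl) (simp add: F(2)[OF J(2)[OF j]] unit_orbit_cong)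
    also have "\<dots> = F (h j)" using pos[of "h j"] by simp
    finally show "F (h j) = (\<Sum>v\<in>columns. if h j \<in> unit_orbit v then F v / card (unit_orbit v) else 0)"
      by simp
  qed
  also have "\<dots> = (\<Sum>v\<in>columns. \<Sum>j\<in>J. if h j \<in> unit_orbit v then F v / card (unit_orbit v) else 0)"
    by (rule sum.swap)
  also have "\<dots> = (\<Sum>v\<in>columns. a * F v)"
  proof (rule sum.cong[OF refl])
    fix v assume v: "v \<in> columns"
    have "(\<Sum>j\<in>J. if h j \<in> unit_orbit v then F v / card (unit_orbit v) else 0)
      = real (card {j \<in> J. h j \<in> unit_orbit v}) * (F v / card (unit_orbit v))"
      using J(1) by (simp add: sum.If_cases Int_def)
    also have "\<dots> = a * F v"
    proof (cases "v = 0\<^sub>v K")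
      case False
      then show ?thesis using mult[of v] v pos[of v] by simp
    qed (use F(1) in simp)
    finally show "(\<Sum>j\<in>J. if h j \<in> unit_orbit v then F v / card (unit_orbit v) else 0) = a * F v" .
  qed
  finally show ?thesis by (simp add: sum_distrib_left)
qed

lemma card_nonzero_columns:
  assumes J: "finite J" "\<And>j. j \<in> J \<Longrightarrow> h j \<in> columns"
    and mult: "\<And>v. v \<in> columns - {0\<^sub>v K} \<Longrightarrow>
      real (card {j \<in> J. h j \<in> unit_orbit v}) = a * real (card (unit_orbit v))"
  shows "real (card {j \<in> J. h j \<noteq> 0\<^sub>v K}) = a * (real (card columns) - 1)"
proof -
  let ?F = "\<lambda>v. if v \<noteq> 0\<^sub>v K then 1 else 0 :: real"
  have "(\<Sum>j\<in>J. ?F (h j)) = a * (\<Sum>v\<in>columns. ?F v)"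
  proof (rule sum_over_columns[OF J mult])
    show "?F w = ?F v" if "w \<in> unit_orbit v" for v w :: "'a vec"
      using unit_orbit_cong[OF that] mem_unit_orbit_zero_iff[of K v] mem_unit_orbit_zero_iff[of K w]
      by auto
  qed auto
  moreover have "(\<Sum>v\<in>columns. ?F v) = real (card columns) - 1"
  proof -
    have "{v \<in> columns. v \<noteq> 0\<^sub>v K} = columns - {0\<^sub>v K}" by auto
    moreover have "card columns > 0" using finite_columns zero_columns by (auto simp: card_gt_0_iff)
    ultimately show ?thesis
      using finite_columns zero_columns by (simp add: sum.If_cases Int_def Suc_leI)
  qed
  ultimately show ?thesis using J(1) by (simp add: sum.If_cases Int_def)
qed

text \<open>Converse of \<open>orbit_multiplicity\<close>: multiplicities proportional to the orbit
  sizes reproduce, up to the factor \<open>a\<close>, the weight of the code with all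
  columns.\<close>

lemma columns_weight:
  assumes J: "finite J" "\<And>j. j \<in> J \<Longrightarrow> h j \<in> columns"
    and mult: "\<And>v. v \<in> columns - {0\<^sub>v K} \<Longrightarrow>
      real (card {j \<in> J. h j \<in> unit_orbit v}) = a * real (card (unit_orbit v))"
    and x: "x \<in> carrier_vec K" "x \<notin> relations"
  shows "(\<Sum>j\<in>J. wt_elem \<gamma> (h j \<bullet> x)) = a * real (card columns)"
proof -
  have "(\<Sum>j\<in>J. wt_elem \<gamma> (h j \<bullet> x)) = a * (\<Sum>v\<in>columns. wt_elem \<gamma> (v \<bullet> x))"
  proof (rule sum_over_columns[OF J mult, of "\<lambda>v. wt_elem \<gamma> (v \<bullet> x)"])
    show "wt_elem \<gamma> (w \<bullet> x) = wt_elem \<gamma> (v \<bullet> x)" if "v \<in> columns" "w \<in> unit_orbit v" for v w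
      using wt_elem_orbit[OF that(2) columns_carrier[OF that(1)] x(1)] .
  qed (use x(1) in auto)
  then show ?thesis by (simp only: sum_wt_columns[OF x])
qed

text \<open>An orbit in the socle has exactly \<open>q - 1\<close> elements, so it reads off the multiplicity \<open>l\<close>.\<close>

lemma constant_weight_multiplicity:
  assumes J: "finite J" "\<And>j. j \<in> J \<Longrightarrow> h j \<in> columns"
    and ker: "\<And>x. x \<in> carrier_vec K - relations \<Longrightarrow> \<exists>j\<in>J. h j \<bullet> x \<noteq> 0"
    and w: "\<And>x. x \<in> carrier_vec K - relations \<Longrightarrow> (\<Sum>j\<in>J. wt_elem \<gamma> (h j \<bullet> x)) = w"
  obtains l :: nat where "l > 0" "\<And>v. v \<in> columns - {0\<^sub>v K} \<Longrightarrow>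
    real (card {j \<in> J. h j \<in> unit_orbit v}) = real l / (real q - 1) * real (card (unit_orbit v))"
proof (cases "K = 0")
  \<comment> \<open>Without rows there are no nonzero columns, so any positive \<open>l\<close> will
    do.\<close>
  case True
  have "v = 0\<^sub>v K" if "v \<in> columns" for v using columns_carrier[OF that] True by auto
  then show ?thesis using that[of 1] by auto
next
  case False
  \<comment> \<open>A vector in the socle, which belongs to \<open>columns\<close> whatever the
    level of row 0, since levels are below \<open>s\<close>.\<close>
  let ?v = "\<gamma> ^ (s - 1) \<cdot>\<^sub>v unit_vec K 0"
  have dvd: "\<gamma> ^ lev 0 dvd \<gamma> ^ (s - 1)" using lev_less[of 0] False by (intro le_imp_power_dvd) simp
  have vK: "?v \<in> carrier_vec K" by simp
  have v: "?v \<in> columns" unfolding columns_def ideal_gen_def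
  proof (intro CollectI conjI allI impI)
    fix r assume "r < K"
    then show "\<gamma> ^ lev r dvd ?v $ r" using dvd by (cases "r = 0") auto
  qed simp
  have v0: "?v $ 0 = \<gamma> ^ (s - 1)" using False by simp
  then have "?v \<noteq> 0\<^sub>v K" using False socle_generator_nonzero by (metis gr0I index_zero_vec(1))
  \<comment> \<open>The maximal ideal kills the socle, so the second factor in
    \<open>card_unit_orbit\<close> is 1.\<close>
  have "(\<lambda>r. r \<cdot>\<^sub>v ?v) ` ideal_gen \<gamma> = {0\<^sub>v K}"
  proof -
    have "r \<cdot>\<^sub>v ?v = 0\<^sub>v K" if "\<gamma> dvd r" for r
      using nonunit_mult_socle[of r] that not_unit_iff[of r] by (intro eq_vecI) (auto simp del: One_nat_def)
    moreover have "0 \<in> ideal_gen \<gamma>" by (simp add: ideal_gen_def)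
    ultimately show ?thesis by (auto simp: ideal_gen_def simp del: One_nat_def)
  qed
  then have card_v: "card (unit_orbit ?v) = q - 1"
    using card_unit_orbit[OF vK \<open>?v \<noteq> 0\<^sub>v K\<close>] by simp
  define l where "l = card {j \<in> J. h j \<in> unit_orbit ?v}"
  have mult: "real (card {j \<in> J. h j \<in> unit_orbit v}) = w / real (card columns) * real (card (unit_orbit v))"
    if "v \<in> columns - {0\<^sub>v K}" for v
    by (rule orbit_multiplicity[OF J w that])
  have "real l = w / real (card columns) * (real q - 1)"
    unfolding l_def using mult[of ?v] v \<open>?v \<noteq> 0\<^sub>v K\<close> card_v q_ge_2 by (simp del: One_nat_def)
  then have l: "w / real (card columns) = real l / (real q - 1)" using q_ge_2 by simp
  \<comment> \<open>The first unit vector is no relation because \<open>?v\<close> does not kill it,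
    so it yields a nonzero codeword.\<close>
  have "w > 0"
  proof -
    let ?e = "unit_vec K 0 :: 'a vec"
    have "?v \<bullet> ?e \<noteq> 0" using v0 vK False socle_generator_nonzero by (simp del: One_nat_def)
    then have e: "?e \<in> carrier_vec K - relations" using relations_annihilate[OF v, of ?e] by auto
    then obtain j where j: "j \<in> J" "h j \<bullet> ?e \<noteq> 0" using ker by blast
    have "0 < (\<Sum>j\<in>J. wt_elem \<gamma> (h j \<bullet> ?e))"
      using J(1) j wt_elem_pos wt_elem_nonneg by (intro sum_pos2[of J j]) auto
    then show ?thesis using w[OF e] by simp
  qed
  moreover have "card columns > 0" using finite_columns zero_columns by (auto simp: card_gt_0_iff)
  ultimately have "real l / (real q - 1) > 0" unfolding l[symmetric] by simp
  then have "l > 0" by (cases "l = 0") auto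
  then show ?thesis using that mult unfolding l by blast
qed

text \<open>Every nonzero orbit has a size divisible by \<open>q - 1\<close>; a subset
  \<open>B X\<close> with \<open>card X / (q - 1)\<close> elements is chosen in each orbit, and the
  union of these is enumerated.\<close>

lemma balanced_columns_exist:
  obtains n :: nat and h :: "nat \<Rightarrow> 'a vec" where "\<forall>j<n. h j \<in> columns - {0\<^sub>v K}"
    "\<forall>v\<in>columns - {0\<^sub>v K}.
      real (card {j \<in> {..<n}. h j \<in> unit_orbit v}) = 1 / (real q - 1) * real (card (unit_orbit v))"
proof -
  let ?Orb = "unit_orbit ` (columns - {0\<^sub>v K})"
  have "\<exists>B \<subseteq> X. card X = (q - 1) * card B" if "X \<in> ?Orb" for X
  proof -
    obtain v where v: "v \<in> columns" "v \<noteq> 0\<^sub>v K" "X = unit_orbit v" using \<open>X \<in> ?Orb\<close> by auto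
    then have X: "card X = (q - 1) * card ((\<lambda>r. r \<cdot>\<^sub>v v) ` ideal_gen \<gamma>)"
      using card_unit_orbit columns_carrier by blast
    have "card ((\<lambda>r. r \<cdot>\<^sub>v v) ` ideal_gen \<gamma>) \<le> card X" 
      unfolding X using q_ge_2 mult_le_mono1[of 1 "q - 1" "card ((\<lambda>r. r \<cdot>\<^sub>v v) ` ideal_gen \<gamma>)"] by linarith
    then show ?thesis using X obtain_subset_with_card_n by metis
  qed
  then obtain B where B: "\<And>X. X \<in> ?Orb \<Longrightarrow> B X \<subseteq> X" "\<And>X. X \<in> ?Orb \<Longrightarrow> card X = (q - 1) * card (B X)"
    by metis
  define T where "T = (\<Union>X\<in>?Orb. B X)"
  have T: "T \<subseteq> columns - {0\<^sub>v K}"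
  proof
    fix z assume "z \<in> T"
    then obtain v where v: "v \<in> columns" "v \<noteq> 0\<^sub>v K" "z \<in> unit_orbit v"
      unfolding T_def using B(1) by blast
    then show "z \<in> columns - {0\<^sub>v K}"
      using unit_orbit_columns mem_unit_orbit_zero_iff by blast
  qed
  then have "finite T" using finite_columns finite_subset by blast
  then obtain h where h: "bij_betw h {0..<card T} T" using ex_bij_betw_nat_finite by blast
  have mult: "real (card {j \<in> {..<card T}. h j \<in> unit_orbit v}) = 1 / (real q - 1) * real (card (unit_orbit v))"
    if v: "v \<in> columns - {0\<^sub>v K}" for v
  proof -
    have O: "unit_orbit v \<in> ?Orb" using v by blast
    \<comment> \<open>Distinct orbits are disjoint, so no other chosen subset meets this
      orbit.\<close>
    have "T \<inter> unit_orbit v = B (unit_orbit v)"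
    proof
      show "B (unit_orbit v) \<subseteq> T \<inter> unit_orbit v" unfolding T_def using B(1) O by blast
      show "T \<inter> unit_orbit v \<subseteq> B (unit_orbit v)"
      proof
        fix z assume z: "z \<in> T \<inter> unit_orbit v"
        then obtain v' where v': "v' \<in> columns - {0\<^sub>v K}" "z \<in> B (unit_orbit v')"
          unfolding T_def by blast
        then have "z \<in> unit_orbit v'" using B(1) by blast
        then have "unit_orbit v' = unit_orbit v" using z unit_orbit_cong by blast
        then show "z \<in> B (unit_orbit v)" using v'(2) by simp
      qed
    qed
    moreover have "bij_betw h {j \<in> {..<card T}. h j \<in> unit_orbit v} (T \<inter> unit_orbit v)"
      using h by (auto simp: bij_betw_def inj_on_def atLeast0LessThan)
    ultimately have "card {j \<in> {..<card T}. h j \<in> unit_orbit v} = card (B (unit_orbit v))"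
      by (simp add: bij_betw_same_card)
    then show ?thesis using B(2)[OF O] q_ge_2 by simp
  qed
  show thesis
    by (rule that[of "card T" h]) (use h T mult in \<open>auto simp: bij_betw_def atLeast0LessThan\<close>)
qed

end

section \<open>Codes given by their columns\<close>

text \<open>\<open>x\<close> holds the coefficients of a combination of the rows of the matrix with
  columns \<open>h j\<close>. In this form, permutations and unit multiples of coordinates act on
  \<open>h\<close> alone.\<close>

definition code_of :: "nat \<Rightarrow> nat \<Rightarrow> (nat \<Rightarrow> 'a::comm_ring_1 vec) \<Rightarrow> 'a vec set" where
  "code_of K n h = (\<lambda>x. vec n (\<lambda>j. h j \<bullet> x)) ` carrier_vec K"

lemma generator_matrix_iff:
  "generator_matrix K n G C \<longleftrightarrow> G \<in> carrier_mat K n \<and> C = code_of K n (col G)"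
proof -
  have "transpose_mat G *\<^sub>v x = vec n (\<lambda>j. col G j \<bullet> x)" if "G \<in> carrier_mat K n" for x
    using that by (intro eq_vecI) auto
  then show ?thesis by (auto simp: generator_matrix_def code_of_def)
qed

lemma code_of_cong: "(\<And>j. j < n \<Longrightarrow> h j = h' j) \<Longrightarrow> code_of K n h = code_of K n h'"
  unfolding code_of_def by (intro image_cong eq_vecI) auto

lemma generator_matrix_of_columns:
  assumes "\<And>j. j < n \<Longrightarrow> h j \<in> carrier_vec K"
  obtains G where "generator_matrix K n G (code_of K n h)" "\<forall>j<n. col G j = h j"
proof -
  let ?G = "mat K n (\<lambda>(r, j). h j $ r)"
  have col: "col ?G j = h j" if "j < n" for j
    using that assms[OF that] by (intro eq_vecI) auto
  then have "code_of K n (col ?G) = code_of K n h" by (rule code_of_cong)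
  then show thesis using that[of ?G] col by (simp add: generator_matrix_iff)
qed

lemma linear_code_code_of:
  assumes h: "\<And>j. j < n \<Longrightarrow> h j \<in> carrier_vec K"
  shows "linear_code n (code_of K n h)"
  unfolding linear_code_def
proof (intro conjI ballI allI)
  show "code_of K n h \<subseteq> carrier_vec n" by (auto simp: code_of_def)
  show "0\<^sub>v n \<in> code_of K n h"
    unfolding code_of_def by (rule image_eqI[of _ _ "0\<^sub>v K"]) (use h in \<open>auto intro!: eq_vecI\<close>)
next
  fix c d assume "c \<in> code_of K n h" "d \<in> code_of K n h"
  then obtain x y where "x \<in> carrier_vec K" "y \<in> carrier_vec K"
    "c = vec n (\<lambda>j. h j \<bullet> x)" "d = vec n (\<lambda>j. h j \<bullet> y)" by (auto simp: code_of_def)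
  then show "c + d \<in> code_of K n h"
    unfolding code_of_def
    by (intro image_eqI[of _ _ "x + y"]) (use h in \<open>auto simp: scalar_prod_add_distrib[of _ K] intro!: eq_vecI\<close>)
next
  fix r c assume "c \<in> code_of K n h"
  then obtain x where "x \<in> carrier_vec K" "c = vec n (\<lambda>j. h j \<bullet> x)" by (auto simp: code_of_def)
  then show "r \<cdot>\<^sub>v c \<in> code_of K n h"
    unfolding code_of_def
    by (intro image_eqI[of _ _ "r \<cdot>\<^sub>v x"]) (use h in \<open>auto simp: scalar_prod_smult_distrib[of _ K] intro!: eq_vecI\<close>)
qed

text \<open>The fibres of the encoding map are translates of its kernel; vectors have inverses only
  within a fixed dimension, so the translation is given explicitly.\<close>

lemma card_code_of:
  fixes h :: "nat \<Rightarrow> 'a::{comm_ring_1,finite} vec"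
  assumes h: "\<And>j. j < n \<Longrightarrow> h j \<in> carrier_vec K"
  shows "card (carrier_vec K :: 'a vec set) =
    card (code_of K n h) * card {x \<in> carrier_vec K. \<forall>j<n. h j \<bullet> x = 0}" (is "_ = _ * card ?H")
  unfolding code_of_def
proof (rule card_fibres[OF finite_carrier_vec_finite])
  let ?f = "\<lambda>x. vec n (\<lambda>j. h j \<bullet> x)"
  fix y assume "y \<in> ?f ` carrier_vec K"
  then obtain x where x: "x \<in> carrier_vec K" "y = ?f x" by blast
  have "bij_betw (\<lambda>a. x + a) ?H {z \<in> carrier_vec K. ?f z = y}"
  proof (rule bij_betw_byWitness[of _ "\<lambda>z. z - x"])
    show "\<forall>a\<in>?H. x + a - x = a" "\<forall>z\<in>{z \<in> carrier_vec K. ?f z = y}. x + (z - x) = z"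
      using x(1) by (auto intro!: eq_vecI)
    show "(\<lambda>a. x + a) ` ?H \<subseteq> {z \<in> carrier_vec K. ?f z = y}"
      using x h by (auto simp: scalar_prod_add_distrib[of _ K] intro!: eq_vecI)
    show "(\<lambda>z. z - x) ` {z \<in> carrier_vec K. ?f z = y} \<subseteq> ?H"
      using x h by (auto simp: scalar_prod_minus_distrib[of _ K] vec_eq_iff)
  qed
  then show "card {z \<in> carrier_vec K. ?f z = y} = card ?H"
    by (simp add: bij_betw_same_card)
qed

lemma append_zeros_replication_code_of:
  assumes h: "\<And>j. j < n \<Longrightarrow> h j \<in> carrier_vec K"
  shows "append_zeros z (replication l (code_of K n h)) =
    code_of K (l * n + z) (\<lambda>j. if j < l * n then h (j mod n) else 0\<^sub>v K)"
proof -
  have "vec (l * n) (\<lambda>i. vec n (\<lambda>j. h j \<bullet> x) $ (i mod n)) @\<^sub>v 0\<^sub>v z =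
    vec (l * n + z) (\<lambda>j. (if j < l * n then h (j mod n) else 0\<^sub>v K) \<bullet> x)" if "x \<in> carrier_vec K" for x
  proof (rule eq_vecI)
    fix i assume i: "i < dim_vec (vec (l * n + z) (\<lambda>j. (if j < l * n then h (j mod n) else 0\<^sub>v K) \<bullet> x))"
    have "i mod n < n" if "i < l * n" using that by (cases n) auto
    then show "(vec (l * n) (\<lambda>i. vec n (\<lambda>j. h j \<bullet> x) $ (i mod n)) @\<^sub>v 0\<^sub>v z) $ i =
      vec (l * n + z) (\<lambda>j. (if j < l * n then h (j mod n) else 0\<^sub>v K) \<bullet> x) $ i"
      using i \<open>x \<in> carrier_vec K\<close> by (auto simp: index_append_vec)
  qed simp
  then show ?thesis
    unfolding append_zeros_def replication_def code_of_def image_image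
    by (intro image_cong) auto
qed

lemma card_periodic:
  "card {j \<in> {..<l * n}. P (j mod n)} = l * card {j \<in> {..<n}. P (j :: nat)}"
proof (induction l)
  case (Suc l)
  have "{j \<in> {..<Suc l * n}. P (j mod n)} =
    {j \<in> {..<l * n}. P (j mod n)} \<union> (\<lambda>j. l * n + j) ` {j \<in> {..<n}. P j}" (is "?A = ?B \<union> ?C")
  proof (intro equalityI subsetI)
    fix j assume j: "j \<in> ?A"
    show "j \<in> ?B \<union> ?C"
    proof (cases "j < l * n")
      case False
      then have "j = l * n + (j - l * n)" "j - l * n < n" using j by auto
      moreover from this have "j mod n = j - l * n"
        using mod_mult_self3[of l n "j - l * n"] by simp
      then have "P (j - l * n)" using j by simp
      ultimately show ?thesis by blast
    qed (use j in auto)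
  qed auto
  moreover have "?B \<inter> ?C = {}" by auto
  ultimately have "card ?A = card ?B + card ?C" by (simp add: card_Un_disjoint)
  also have "card ?C = card {j \<in> {..<n}. P j}" by (simp add: card_image inj_on_def)
  finally show ?case using Suc by simp
qed simp

text \<open>Scalar products with unit vectors recover all entries of a column, so a coordinate
  vanishes on the code only if its column does.\<close>

lemma zero_coords_code_of:
  fixes h :: "nat \<Rightarrow> 'a::comm_ring_1 vec"
  assumes h: "\<And>j. j < n \<Longrightarrow> h j \<in> carrier_vec K"
  shows "zero_coords n (code_of K n h) = {j \<in> {..<n}. h j = 0\<^sub>v K}"
proof -
  have zero: "h j = 0\<^sub>v K" if j: "j < n" and "\<forall>x\<in>carrier_vec K. h j \<bullet> x = 0" for j
  proof (rule eq_vecI)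
    fix r assume "r < dim_vec (0\<^sub>v K)"
    then show "h j $ r = 0\<^sub>v K $ r"
      using bspec[OF that(2), of "unit_vec K r"] h[OF j] by simp
  qed (use h[OF j] in simp)
  moreover have "zero_coords n (code_of K n h) = {j \<in> {..<n}. \<forall>x\<in>carrier_vec K. h j \<bullet> x = 0}"
    unfolding zero_coords_def code_of_def by (simp cong: conj_cong)
  moreover have "(\<forall>x\<in>carrier_vec K. h j \<bullet> x = 0) \<longleftrightarrow> h j = 0\<^sub>v K" if "j < n" for j
  proof
    assume "h j = 0\<^sub>v K"
    then show "\<forall>x\<in>carrier_vec K. h j \<bullet> x = 0" by simp
  qed (rule zero[OF that])
  ultimately show ?thesis by (simp cong: conj_cong)
qed

text \<open>Equal counts make the multisets of column orbits equal, so a permutation matches the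
  orbits; matched columns differ by a unit.\<close>

lemma code_equiv_of_orbits:
  assumes h: "\<And>j. j < n \<Longrightarrow> h j \<in> carrier_vec K" "\<And>j. j < n \<Longrightarrow> h' j \<in> carrier_vec K"
    and count: "\<And>v. v \<in> carrier_vec K \<Longrightarrow>
      card {j \<in> {..<n}. h j \<in> unit_orbit v} = card {j \<in> {..<n}. h' j \<in> unit_orbit (v :: 'a::comm_ring_1 vec)}"
  shows "code_equiv n (code_of K n h) (code_of K n h')"
proof -
  have cnt: "count (image_mset (\<lambda>j. unit_orbit (g j)) (mset_set {..<n})) X = card {j \<in> {..<n}. unit_orbit (g j) = X}"
    for g :: "nat \<Rightarrow> 'a vec" and X
    by (simp add: count_image_mset Int_def vimage_def conj_commute)
  have "image_mset (\<lambda>j. unit_orbit (h' j)) (mset_set {..<n}) = image_mset (\<lambda>j. unit_orbit (h j)) (mset_set {..<n})"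
  proof (rule multiset_eqI, unfold cnt)
    fix X
    show "card {j \<in> {..<n}. unit_orbit (h' j) = X} = card {j \<in> {..<n}. unit_orbit (h j) = X}"
    proof (cases "\<exists>v\<in>carrier_vec K. X = unit_orbit v")
      case True
      then show ?thesis using count by (auto simp: unit_orbit_eq_iff)
    next
      case False
      then have "{j \<in> {..<n}. unit_orbit (h' j) = X} = {}" "{j \<in> {..<n}. unit_orbit (h j) = X} = {}"
        using h by blast+
      then show ?thesis by (simp only:)
    qed
  qed
  then obtain p where p: "p permutes {..<n}" "\<forall>j\<in>{..<n}. unit_orbit (h' j) = unit_orbit (h (p j))"
    by (rule image_mset_eq_implies_permutes[OF finite_lessThan])
  then have "\<forall>j\<in>{..<n}. \<exists>u. u dvd 1 \<and> h' j = u \<cdot>\<^sub>v h (p j)"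
    unfolding unit_orbit_eq_iff by (auto simp: unit_orbit_def)
  then obtain u where u: "\<And>j. j < n \<Longrightarrow> u j dvd 1 \<and> h' j = u j \<cdot>\<^sub>v h (p j)" by (metis lessThan_iff)
  have pn: "p j < n" if "j < n" for j using permutes_in_image[OF p(1), of j] that by simp
  have inv_n: "inv_into UNIV p i < n" if "i < n" for i
    using permutes_in_image[OF permutes_inv[OF p(1)], of i] that by simp
  \<comment> \<open>\<open>code_equiv\<close> attaches units to the source coordinate
    \<open>p i\<close>, whereas \<open>u\<close> is indexed by the target coordinate
    \<open>i\<close>; hence the inverse of \<open>p\<close>.\<close>
  have "code_of K n h' = (\<lambda>c. vec n (\<lambda>i. c $ p i * u (inv_into UNIV p (p i)))) ` code_of K n h"
    unfolding code_of_def image_image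
  proof (rule image_cong[OF refl], rule eq_vecI)
    fix x :: "'a vec" and i
    assume x: "x \<in> carrier_vec K" and "i < dim_vec (vec n (\<lambda>i. vec n (\<lambda>j. h j \<bullet> x) $ p i * u (inv_into UNIV p (p i))))"
    then have i: "i < n" by simp
    have "h' i \<bullet> x = u i * (h (p i) \<bullet> x)" using u[OF i] h(1)[OF pn[OF i]] x by simp
    then show "vec n (\<lambda>j. h' j \<bullet> x) $ i = vec n (\<lambda>i. vec n (\<lambda>j. h j \<bullet> x) $ p i * u (inv_into UNIV p (p i))) $ i"
      using i pn permutes_inverses(2)[OF p(1)] by (simp add: mult.commute)
  qed simp
  moreover have "\<forall>i<n. u (inv_into UNIV p i) dvd 1" using u inv_n by blast
  moreover have "code_of K n h \<subseteq> carrier_vec n" by (auto simp: code_of_def)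
  ultimately show ?thesis
    unfolding code_equiv_def using p(1)
    by (intro conjI exI[of _ "\<lambda>i. u (inv_into UNIV p i)"] exI[of _ p]) simp_all
qed

section \<open>Constant weight and replication in terms of columns\<close>

context leveled_chain_ring
begin

lemma constant_weight_code_of_iff:
  assumes h: "\<And>j. j < n \<Longrightarrow> h j \<in> columns"
    and ker: "{x \<in> carrier_vec K. \<forall>j<n. h j \<bullet> x = 0} = relations"
  shows "constant_weight \<gamma> n (code_of K n h) w \<longleftrightarrow>
    (\<forall>x\<in>carrier_vec K - relations. (\<Sum>j<n. wt_elem \<gamma> (h j \<bullet> x)) = w)"
proof -
  have wt: "wt_hom \<gamma> (vec n (\<lambda>j. h j \<bullet> x)) = (\<Sum>j<n. wt_elem \<gamma> (h j \<bullet> x))" for x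
    by (simp add: wt_hom_def)
  have "code_of K n h - {0\<^sub>v n} = (\<lambda>x. vec n (\<lambda>j. h j \<bullet> x)) ` (carrier_vec K - relations)"
    unfolding code_of_def ker[symmetric] by (auto simp: vec_eq_iff)
  then show ?thesis by (simp add: constant_weight_def wt)
qed

text \<open>Each nonzero orbit occurs \<open>l\<close> times as often among the columns
  \<open>h'\<close> as among \<open>h\<close>, and the zero columns are matched by the padding; so
  the orbit counts agree.\<close>

lemma replication_equiv:
  assumes h: "\<And>j. j < n \<Longrightarrow> h j \<in> columns - {0\<^sub>v K}"
    and mult: "\<And>v. v \<in> columns - {0\<^sub>v K} \<Longrightarrow>
      real (card {j \<in> {..<n}. h j \<in> unit_orbit v}) = 1 / (real q - 1) * real (card (unit_orbit v))"
    and h': "\<And>j. j < n' \<Longrightarrow> h' j \<in> columns"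
    and mult': "\<And>v. v \<in> columns - {0\<^sub>v K} \<Longrightarrow>
      real (card {j \<in> {..<n'}. h' j \<in> unit_orbit v}) = real l / (real q - 1) * real (card (unit_orbit v))"
    and z: "z = card (zero_coords n' (code_of K n' h'))"
  shows "n' = l * n + z"
    and "code_equiv n' (append_zeros z (replication l (code_of K n h))) (code_of K n' h')"
proof -
  have "{j \<in> {..<n}. h j \<noteq> 0\<^sub>v K} = {..<n}" using h by auto
  then have n: "real n = 1 / (real q - 1) * (real (card columns) - 1)"
    using card_nonzero_columns[of "{..<n}" h, OF _ _ mult] h by simp
  have nz: "real (card {j \<in> {..<n'}. h' j \<noteq> 0\<^sub>v K}) = real l / (real q - 1) * (real (card columns) - 1)"
    using card_nonzero_columns[of "{..<n'}" h', OF _ _ mult'] h' by simp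
  then have "real (card {j \<in> {..<n'}. h' j \<noteq> 0\<^sub>v K}) = real (l * n)"
    using n by simp
  then have nz': "card {j \<in> {..<n'}. h' j \<noteq> 0\<^sub>v K} = l * n" by (simp only: of_nat_eq_iff)
  have z': "z = card {j \<in> {..<n'}. h' j = 0\<^sub>v K}"
    unfolding z by (subst zero_coords_code_of[OF columns_carrier[OF h']]) simp_all
  have "card ({j \<in> {..<n'}. h' j \<noteq> 0\<^sub>v K} \<union> {j \<in> {..<n'}. h' j = 0\<^sub>v K}) = l * n + z"
    unfolding nz'[symmetric] z' by (rule card_Un_disjoint) auto
  moreover have "{j \<in> {..<n'}. h' j \<noteq> 0\<^sub>v K} \<union> {j \<in> {..<n'}. h' j = 0\<^sub>v K} = {..<n'}" by auto
  ultimately show n': "n' = l * n + z" by (simp only: card_lessThan)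
  \<comment> \<open>The columns of the replicated and padded code.\<close>
  define g where "g = (\<lambda>j. if j < l * n then h (j mod n) else 0\<^sub>v K)"
  have modn: "j mod n < n" if "j < l * n" for j using that by (cases n) auto
  have g: "g j \<in> columns" for j
    using h modn zero_columns by (auto simp: g_def)
  have g0: "g j = 0\<^sub>v K \<longleftrightarrow> l * n \<le> j" for j
    using h modn by (auto simp: g_def)
  have count: "card {j \<in> {..<n'}. g j \<in> unit_orbit v} = card {j \<in> {..<n'}. h' j \<in> unit_orbit v}"
    if v: "v \<in> carrier_vec K" for v
  proof -
    \<comment> \<open>The zero orbit counts the padding, an orbit outside \<open>columns\<close> is
      never met, and any other orbit is counted once per block of the replication.\<close>
    consider "v = 0\<^sub>v K" | "v \<notin> columns" | "v \<in> columns - {0\<^sub>v K}" by blast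
    then show ?thesis
    proof cases
      case 1
      have "{j \<in> {..<n'}. g j \<in> unit_orbit v} = {l * n..<n'}"
        unfolding 1 unit_orbit_zero singleton_iff g0 by (simp add: set_eq_iff conj_commute)
      then have "card {j \<in> {..<n'}. g j \<in> unit_orbit v} = z" by (simp add: n')
      also have "z = card {j \<in> {..<n'}. h' j \<in> unit_orbit v}"
        by (simp add: 1 unit_orbit_zero z')
      finally show ?thesis .
    next
      case 2
      have *: "w \<notin> unit_orbit v" if "w \<in> columns" for w
        using that 2 unit_orbit_columns[OF that] mem_unit_orbit_sym[of w v] by blast
      have "{j \<in> {..<n'}. g j \<in> unit_orbit v} = {}" "{j \<in> {..<n'}. h' j \<in> unit_orbit v} = {}"
        using *[OF g] *[OF h'] by blast+
      then show ?thesis by (simp only:)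
    next
      case 3
      have "{j \<in> {..<n'}. g j \<in> unit_orbit v} = {j \<in> {..<l * n}. h (j mod n) \<in> unit_orbit v}"
      proof (rule Collect_cong)
        fix j
        have "0\<^sub>v K \<notin> unit_orbit v" using 3 mem_unit_orbit_zero_iff[of K v] by blast
        then have "g j \<in> unit_orbit v \<longleftrightarrow> j < l * n \<and> h (j mod n) \<in> unit_orbit v"
          unfolding g_def by (cases "j < l * n") simp_all
        moreover have "l * n \<le> n'" unfolding n' by (rule le_add1)
        ultimately show "j \<in> {..<n'} \<and> g j \<in> unit_orbit v \<longleftrightarrow>
            j \<in> {..<l * n} \<and> h (j mod n) \<in> unit_orbit v"
          unfolding lessThan_iff using less_le_trans by blast
      qed
      then have "card {j \<in> {..<n'}. g j \<in> unit_orbit v} = l * card {j \<in> {..<n}. h j \<in> unit_orbit v}"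
        by (simp only: card_periodic[of l n "\<lambda>j. h j \<in> unit_orbit v"])
      then have "real (card {j \<in> {..<n'}. g j \<in> unit_orbit v}) =
          real l * real (card {j \<in> {..<n}. h j \<in> unit_orbit v})"
        by (simp only: of_nat_mult)
      also have "\<dots> = real (card {j \<in> {..<n'}. h' j \<in> unit_orbit v})"
        unfolding mult[OF 3] mult'[OF 3] by simp
      finally have "real (card {j \<in> {..<n'}. g j \<in> unit_orbit v}) = real (card {j \<in> {..<n'}. h' j \<in> unit_orbit v})" .
      then show ?thesis by (simp only: of_nat_eq_iff)
    qed
  qed
  have "code_equiv n' (code_of K n' g) (code_of K n' h')"
    by (rule code_equiv_of_orbits[OF columns_carrier[OF g] columns_carrier[OF h'] count])
  moreover have "append_zeros z (replication l (code_of K n h)) = code_of K n' g"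
    unfolding g_def n' by (rule append_zeros_replication_code_of) (use h columns_carrier in auto)
  ultimately show "code_equiv n' (append_zeros z (replication l (code_of K n h))) (code_of K n' h')"
    by simp
qed

end

section \<open>Codes of a given subtype\<close>

text \<open>The row numbering of \<open>column_space\<close>, as a function on the pairs of
  \<open>subtype_index\<close>.\<close>

definition block_position :: "(nat \<Rightarrow> nat) \<Rightarrow> nat \<times> nat \<Rightarrow> nat" where
  "block_position k p = (\<Sum>l<fst p. k l) + snd p"

lemma bij_betw_block_position:
  "bij_betw (block_position k) (SIGMA i : {..<m}. {..<k i}) {..<\<Sum>i<m. k i}"
proof (induction m)
  case (Suc m)
  have "bij_betw (block_position k) ({m} \<times> {..<k m}) {(\<Sum>i<m. k i)..<\<Sum>i<Suc m. k i}"
    by (rule bij_betw_byWitness[of _ "\<lambda>r. (m, r - (\<Sum>i<m. k i))"]) (auto simp: block_position_def)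
  with Suc have "bij_betw (block_position k) ((SIGMA i : {..<m}. {..<k i}) \<union> {m} \<times> {..<k m})
      ({..<\<Sum>i<m. k i} \<union> {(\<Sum>i<m. k i)..<\<Sum>i<Suc m. k i})"
    by (rule bij_betw_combine) auto
  moreover have "(SIGMA i : {..<m}. {..<k i}) \<union> {m} \<times> {..<k m} = (SIGMA i : {..<Suc m}. {..<k i})"
    by (auto simp: less_Suc_eq)
  moreover have "{..<\<Sum>i<m. k i} \<union> {(\<Sum>i<m. k i)..<\<Sum>i<Suc m. k i} = {..<\<Sum>i<Suc m. k i}"
    by auto
  ultimately show ?case by simp
qed (simp add: bij_betw_def)

lemma vec_sum_coordinates:
  fixes \<psi> :: "'a::comm_ring_1 vec \<Rightarrow> 'a"
  assumes add: "\<And>x y. x \<in> carrier_vec K \<Longrightarrow> y \<in> carrier_vec K \<Longrightarrow> \<psi> (x + y) = \<psi> x + \<psi> y"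
    and smult: "\<And>x r. x \<in> carrier_vec K \<Longrightarrow> \<psi> (r \<cdot>\<^sub>v x) = r * \<psi> x"
    and x: "x \<in> carrier_vec K"
  shows "\<psi> x = vec K (\<lambda>r. \<psi> (unit_vec K r)) \<bullet> x"
proof -
  \<comment> \<open>Induction over truncations of \<open>x\<close>, filled up with zeros to stay in
    dimension \<open>K\<close>.\<close>
  have "m \<le> K \<Longrightarrow> \<psi> (vec K (\<lambda>i. if i < m then x $ i else 0)) = (\<Sum>r<m. \<psi> (unit_vec K r) * x $ r)" for m
  proof (induction m)
    case 0
    have "\<psi> (0 \<cdot>\<^sub>v x) = 0" using smult[OF x, of 0] by simp
    moreover have "0 \<cdot>\<^sub>v x = vec K (\<lambda>i. 0)" using x by (intro eq_vecI) auto
    ultimately show ?case by simp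
  next
    case (Suc m)
    have "vec K (\<lambda>i. if i < Suc m then x $ i else 0) =
        vec K (\<lambda>i. if i < m then x $ i else 0) + x $ m \<cdot>\<^sub>v unit_vec K m"
      using Suc.prems by (intro eq_vecI) (auto simp: less_Suc_eq)
    then have "\<psi> (vec K (\<lambda>i. if i < Suc m then x $ i else 0)) =
        \<psi> (vec K (\<lambda>i. if i < m then x $ i else 0)) + x $ m * \<psi> (unit_vec K m)"
      by (simp add: add smult)
    then show ?case using Suc by (simp add: mult.commute)
  qed
  from this[of K] have "\<psi> (vec K (\<lambda>i. if i < K then x $ i else 0)) = (\<Sum>r<K. \<psi> (unit_vec K r) * x $ r)"
    by simp
  moreover have "vec K (\<lambda>i. if i < K then x $ i else 0) = x" using x by (intro eq_vecI) auto
  ultimately show ?thesis using x by (simp add: scalar_prod_def atLeast0LessThan)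
qed

section \<open>The module prescribed by the subtype\<close>

locale subtype_chain_ring = finite_chain_ring +
  fixes k :: "nat \<Rightarrow> nat"
begin

text \<open>The block containing row \<open>r\<close>, which is the power of \<gamma> required in
  that row of a column.\<close>

definition level :: "nat \<Rightarrow> nat" where
  "level r = fst (inv_into (subtype_index \<gamma> k) (block_position k) r)"

lemma bij_block_position: "bij_betw (block_position k) (subtype_index \<gamma> k) {..<code_rank \<gamma> k}"
  unfolding subtype_index_def code_rank_def by (rule bij_betw_block_position)

lemma level_block_position: "p \<in> subtype_index \<gamma> k \<Longrightarrow> level (block_position k p) = fst p"
  unfolding level_def using bij_block_position by (simp add: bij_betw_def)

lemma position_less: "p \<in> subtype_index \<gamma> k \<Longrightarrow> block_position k p < code_rank \<gamma> k"
  using bij_block_position by (auto simp: bij_betw_def)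

lemma all_positions:
  "(\<forall>r<code_rank \<gamma> k. P r) \<longleftrightarrow> (\<forall>p\<in>subtype_index \<gamma> k. P (block_position k p))"
proof -
  have "{..<code_rank \<gamma> k} = block_position k ` subtype_index \<gamma> k"
    using bij_block_position by (simp add: bij_betw_def)
  then show ?thesis by (metis (no_types, lifting) image_iff lessThan_iff)
qed

sublocale leveled_chain_ring \<gamma> "code_rank \<gamma> k" level
proof
  have "\<forall>r<code_rank \<gamma> k. level r < s"
    unfolding all_positions by (auto simp: level_block_position) (auto simp: subtype_index_def)
  then show "level r < s" if "r < code_rank \<gamma> k" for r using that by blast
qed

abbreviation K :: nat where "K \<equiv> code_rank \<gamma> k"

lemma column_space_eq: "column_space \<gamma> k = columns"
proof -
  have "(\<forall>r<K. v $ r \<in> ideal_gen (\<gamma> ^ level r)) \<longleftrightarrow>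
      (\<forall>i<s. \<forall>j<k i. v $ ((\<Sum>l<i. k l) + j) \<in> ideal_gen (\<gamma> ^ i))" for v
    unfolding all_positions
    by (simp add: level_block_position cong: ball_cong) (auto simp: subtype_index_def block_position_def)
  then show ?thesis by (simp add: column_space_def columns_def)
qed

text \<open>The projection of the free module of rank \<open>K\<close> onto the product of
  quotients; its kernel is \<open>relations\<close>.\<close>

definition residues :: "'a vec \<Rightarrow> nat \<times> nat \<Rightarrow> 'a set" where
  "residues x = (\<lambda>p\<in>subtype_index \<gamma> k. x $ block_position k p +o subtype_ideal \<gamma> p)"

abbreviation residue_module :: "(nat \<times> nat \<Rightarrow> 'a set) set" where
  "residue_module \<equiv> \<Pi>\<^sub>E p\<in>subtype_index \<gamma> k. quot (subtype_ideal \<gamma> p)"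

lemma is_ideal_subtype_ideal: "is_ideal (subtype_ideal \<gamma> p)"
  by (simp add: subtype_ideal_def is_ideal_ideal_gen)

lemma residues_mem: "residues x \<in> residue_module"
  by (auto simp: residues_def quot_def)

lemma residues_surj:
  assumes "f \<in> residue_module"
  obtains x where "x \<in> carrier_vec K" "f = residues x"
proof -
  have "\<forall>p\<in>subtype_index \<gamma> k. \<exists>a. f p = a +o subtype_ideal \<gamma> p"
    using assms by (auto simp: quot_def PiE_def Pi_def image_iff)
  then obtain a where a: "\<And>p. p \<in> subtype_index \<gamma> k \<Longrightarrow> f p = a p +o subtype_ideal \<gamma> p" by metis
  let ?x = "vec K (\<lambda>r. a (inv_into (subtype_index \<gamma> k) (block_position k) r))"
  have "f = residues ?x"
  proof
    fix p
    show "f p = residues ?x p"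
    proof (cases "p \<in> subtype_index \<gamma> k")
      case True
      moreover have "inv_into (subtype_index \<gamma> k) (block_position k) (block_position k p) = p"
        using True bij_block_position by (simp add: bij_betw_def)
      ultimately show ?thesis using a position_less[OF True] by (simp add: residues_def)
    next
      case False
      then show ?thesis using PiE_arb[OF assms] by (simp add: residues_def)
    qed
  qed
  then show thesis using that[of ?x] by simp
qed

lemma residues_eq_iff:
  assumes "x \<in> carrier_vec K" "y \<in> carrier_vec K"
  shows "residues x = residues y \<longleftrightarrow> x - y \<in> relations"
proof -
  have "residues x = residues y \<longleftrightarrow>
      (\<forall>p\<in>subtype_index \<gamma> k. x $ block_position k p - y $ block_position k p \<in> subtype_ideal \<gamma> p)"
    unfolding residues_def fun_eq_iff restrict_def
    by (auto simp: coset_eq_iff[OF is_ideal_subtype_ideal])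
  also have "\<dots> \<longleftrightarrow> (\<forall>r<K. (x - y) $ r \<in> ideal_gen (\<gamma> ^ (s - level r)))"
    unfolding all_positions using assms
    by (intro ball_cong refl) (simp add: level_block_position position_less subtype_ideal_def)
  finally show ?thesis using assms by (simp add: relations_def)
qed

lemma residues_add:
  assumes "x \<in> carrier_vec K" "y \<in> carrier_vec K" "p \<in> subtype_index \<gamma> k"
  shows "residues (x + y) p = residues x p + residues y p"
  using assms position_less[OF assms(3)]
  by (simp add: residues_def coset_add[OF is_ideal_subtype_ideal])

lemma residues_smult:
  assumes "x \<in> carrier_vec K" "p \<in> subtype_index \<gamma> k"
  shows "residues (r \<cdot>\<^sub>v x) p = quot_scale (subtype_ideal \<gamma> p) r (residues x p)"
  using assms position_less[OF assms(2)]
  by (simp add: residues_def quot_scale_coset[OF is_ideal_subtype_ideal])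

lemma residue_module_eqI:
  assumes "f \<in> residue_module" "g \<in> residue_module" "\<And>p. p \<in> subtype_index \<gamma> k \<Longrightarrow> f p = g p"
  shows "f = g"
  using assms by (rule PiE_ext)

text \<open>The projection \<open>residues\<close> followed by the inverse of the isomorphism is a
  linear map \<psi> onto \<open>C\<close> with kernel \<open>relations\<close>; its coordinate
  functions are scalar products with the required columns.\<close>

lemma columns_of_subtype:
  assumes lin: "linear_code n C" and sub: "has_subtype \<gamma> k C"
  obtains h where "\<forall>j<n. h j \<in> columns" "C = code_of K n h"
    "{x \<in> carrier_vec K. \<forall>j<n. h j \<bullet> x = 0} = relations"
proof -
  obtain \<phi> :: "'a vec \<Rightarrow> nat \<times> nat \<Rightarrow> 'a set" where bij: "bij_betw \<phi> C residue_module"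
    and add: "\<And>c d p. c \<in> C \<Longrightarrow> d \<in> C \<Longrightarrow> p \<in> subtype_index \<gamma> k \<Longrightarrow> \<phi> (c + d) p = \<phi> c p + \<phi> d p"
    and smult: "\<And>r c p. c \<in> C \<Longrightarrow> p \<in> subtype_index \<gamma> k \<Longrightarrow>
      \<phi> (r \<cdot>\<^sub>v c) p = quot_scale (subtype_ideal \<gamma> p) r (\<phi> c p)"
    using sub unfolding has_subtype_def by blast
  have C: "C \<subseteq> carrier_vec n" "\<And>c d. c \<in> C \<Longrightarrow> d \<in> C \<Longrightarrow> c + d \<in> C" "\<And>r c. c \<in> C \<Longrightarrow> r \<cdot>\<^sub>v c \<in> C"
    using lin by (auto simp: linear_code_def)
  define \<psi> where "\<psi> x = inv_into C \<phi> (residues x)" for x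
  have \<psi>: "\<psi> x \<in> C" and \<phi>\<psi>: "\<phi> (\<psi> x) = residues x" for x
    unfolding \<psi>_def using bij residues_mem[of x]
    by (auto simp: bij_betw_def inv_into_into f_inv_into_f)
  have \<phi>_mem: "\<phi> c \<in> residue_module" if "c \<in> C" for c using bij that by (auto simp: bij_betw_def)
  have \<phi>_inj: "c = d" if "c \<in> C" "d \<in> C" "\<phi> c = \<phi> d" for c d
    using bij that by (auto simp: bij_betw_def inj_on_def)
  have \<psi>_add: "\<psi> (x + y) = \<psi> x + \<psi> y" if "x \<in> carrier_vec K" "y \<in> carrier_vec K" for x y
  proof (rule \<phi>_inj)
    show "\<phi> (\<psi> (x + y)) = \<phi> (\<psi> x + \<psi> y)"
      using \<psi> C(2) by (intro residue_module_eqI \<phi>_mem) (simp_all add: add \<phi>\<psi> residues_add that)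
  qed (use \<psi> C(2) in auto)
  have \<psi>_smult: "\<psi> (r \<cdot>\<^sub>v x) = r \<cdot>\<^sub>v \<psi> x" if "x \<in> carrier_vec K" for r x
  proof (rule \<phi>_inj)
    show "\<phi> (\<psi> (r \<cdot>\<^sub>v x)) = \<phi> (r \<cdot>\<^sub>v \<psi> x)"
      using \<psi> C(3) by (intro residue_module_eqI \<phi>_mem) (simp_all add: smult \<phi>\<psi> residues_smult that)
  qed (use \<psi> C(3) in auto)
  have \<psi>_carrier: "\<psi> x \<in> carrier_vec n" for x using \<psi> C(1) by blast
  have \<psi>_zero: "\<psi> (0\<^sub>v K) = 0\<^sub>v n"
  proof -
    have "0\<^sub>v K = 0 \<cdot>\<^sub>v (0\<^sub>v K :: 'a vec)" by (intro eq_vecI) auto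
    then have "\<psi> (0\<^sub>v K) = \<psi> (0 \<cdot>\<^sub>v 0\<^sub>v K)" by (rule arg_cong)
    also have "\<dots> = 0 \<cdot>\<^sub>v \<psi> (0\<^sub>v K)" by (rule \<psi>_smult) simp
    also have "\<dots> = 0\<^sub>v n" using \<psi>_carrier[of "0\<^sub>v K"] by (intro eq_vecI) auto
    finally show ?thesis .
  qed
  have \<psi>_eq_0: "\<psi> x = 0\<^sub>v n \<longleftrightarrow> x \<in> relations" if x: "x \<in> carrier_vec K" for x
  proof -
    have "\<psi> x = 0\<^sub>v n \<longleftrightarrow> \<psi> x = \<psi> (0\<^sub>v K)" by (simp add: \<psi>_zero)
    also have "\<dots> \<longleftrightarrow> residues x = residues (0\<^sub>v K)" using \<phi>_inj[OF \<psi> \<psi>, of x "0\<^sub>v K"] \<phi>\<psi> by metis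
    also have "\<dots> \<longleftrightarrow> x - 0\<^sub>v K \<in> relations" by (rule residues_eq_iff[OF x]) simp
    also have "x - 0\<^sub>v K = x" using x by (intro eq_vecI) auto
    finally show ?thesis .
  qed
  \<comment> \<open>Entry \<open>r\<close> of column \<open>j\<close> is coordinate \<open>j\<close>
    of the image of the unit vector \<open>r\<close>.\<close>
  define h where "h j = vec K (\<lambda>r. \<psi> (unit_vec K r) $ j)" for j
  have \<psi>_h: "\<psi> x = vec n (\<lambda>j. h j \<bullet> x)" if x: "x \<in> carrier_vec K" for x
  proof (rule eq_vecI)
    fix j assume "j < dim_vec (vec n (\<lambda>j. h j \<bullet> x))"
    then have j: "j < n" by simp
    have "\<psi> x $ j = vec K (\<lambda>r. \<psi> (unit_vec K r) $ j) \<bullet> x"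
    proof (rule vec_sum_coordinates[OF _ _ x, of "\<lambda>x. \<psi> x $ j"])
      show "\<psi> (x + y) $ j = \<psi> x $ j + \<psi> y $ j" if "x \<in> carrier_vec K" "y \<in> carrier_vec K" for x y
        using \<psi>_add[OF that] \<psi>_carrier[of y] j by simp
      show "\<psi> (r \<cdot>\<^sub>v x) $ j = r * \<psi> x $ j" if "x \<in> carrier_vec K" for x r
        using \<psi>_smult[OF that] \<psi>_carrier[of x] j by simp
    qed
    then show "\<psi> x $ j = vec n (\<lambda>j. h j \<bullet> x) $ j" using j by (simp add: h_def)
  qed (use \<psi>_carrier[of x] in simp)
  have h_columns: "h j \<in> columns" if j: "j < n" for j
    unfolding columns_def
  proof (intro CollectI conjI allI impI)
    fix r assume r: "r < K"
    \<comment> \<open>This relation is sent to 0, so \<open>\<gamma> ^ (s - level r)\<close> kills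
      entry \<open>r\<close> of each column, which forces divisibility by
      \<open>\<gamma> ^ level r\<close>.\<close>
    let ?e = "\<gamma> ^ (s - level r) \<cdot>\<^sub>v unit_vec K r"
    have "?e \<in> relations" by (auto simp: relations_def ideal_gen_def unit_vec_def)
    then have "\<psi> ?e = 0\<^sub>v n" using \<psi>_eq_0[of ?e] by simp
    then have "\<gamma> ^ (s - level r) * \<psi> (unit_vec K r) $ j = 0"
      using \<psi>_smult[of "unit_vec K r"] \<psi>_carrier[of "unit_vec K r"] j
      by (metis carrier_vecD index_smult_vec(1) index_zero_vec(1) unit_vec_carrier)
    then have "\<gamma> ^ (s - (s - level r)) dvd \<psi> (unit_vec K r) $ j"
      using gamma_pow_mult_eq_0_iff[of "s - level r"] by simp
    then show "h j $ r \<in> ideal_gen (\<gamma> ^ level r)"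
      using lev_less[OF r] r by (simp add: h_def ideal_gen_def)
  qed (simp add: h_def)
  have "\<forall>j<n. h j \<in> columns" using h_columns by blast
  moreover have "C = code_of K n h"
  proof -
    have "C \<subseteq> \<psi> ` carrier_vec K"
    proof
      fix c assume c: "c \<in> C"
      obtain x where "x \<in> carrier_vec K" "\<phi> c = residues x" using residues_surj[OF \<phi>_mem[OF c]] .
      then show "c \<in> \<psi> ` carrier_vec K" using \<phi>_inj[OF c \<psi>[of x]] \<phi>\<psi>[of x] by auto
    qed
    then have "C = \<psi> ` carrier_vec K" using \<psi> by blast
    also have "\<dots> = code_of K n h" unfolding code_of_def by (rule image_cong[OF refl \<psi>_h])
    finally show ?thesis .
  qed
  moreover have "{x \<in> carrier_vec K. \<forall>j<n. h j \<bullet> x = 0} = relations"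
  proof -
    have "(\<forall>j<n. h j \<bullet> x = 0) \<longleftrightarrow> x \<in> relations" if "x \<in> carrier_vec K" for x
      using \<psi>_eq_0[OF that] unfolding \<psi>_h[OF that] by (auto simp: vec_eq_iff)
    moreover have "relations \<subseteq> carrier_vec K" by (auto simp: relations_def)
    ultimately show ?thesis by blast
  qed
  ultimately show thesis by (rule that)
qed

text \<open>The isomorphism sends a codeword to the residues of any of its preimages; the kernel
  condition makes this independent of the choice, and injective.\<close>

lemma has_subtype_code_of:
  assumes h: "\<And>j. j < n \<Longrightarrow> h j \<in> columns"
    and ker: "{x \<in> carrier_vec K. \<forall>j<n. h j \<bullet> x = 0} = relations"
  shows "has_subtype \<gamma> k (code_of K n h)"
proof -
  let ?f = "\<lambda>x. vec n (\<lambda>j. h j \<bullet> x)" and ?C = "code_of K n h"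
  have hK: "h j \<in> carrier_vec K" if "j < n" for j using columns_carrier h that by blast
  have f_add: "?f (x + y) = ?f x + ?f y" if "x \<in> carrier_vec K" "y \<in> carrier_vec K" for x y
    using that hK by (intro eq_vecI) (auto simp: scalar_prod_add_distrib[of _ K])
  have f_smult: "?f (r \<cdot>\<^sub>v x) = r \<cdot>\<^sub>v ?f x" if "x \<in> carrier_vec K" for x r
    using that hK by (intro eq_vecI) (auto simp: scalar_prod_smult_distrib[of _ K])
  have f_eq: "?f x = ?f y \<longleftrightarrow> residues x = residues y" if "x \<in> carrier_vec K" "y \<in> carrier_vec K" for x y
  proof -
    have "?f x = ?f y \<longleftrightarrow> (\<forall>j<n. h j \<bullet> (x - y) = 0)"
      using that hK by (auto simp: vec_eq_iff scalar_prod_minus_distrib[of _ K])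
    also have "\<dots> \<longleftrightarrow> x - y \<in> relations" using that unfolding ker[symmetric] by simp
    finally show ?thesis using residues_eq_iff[OF that] by simp
  qed
  define g where "g c = (SOME x. x \<in> carrier_vec K \<and> ?f x = c)" for c
  have g: "g c \<in> carrier_vec K \<and> ?f (g c) = c" if "c \<in> ?C" for c
  proof -
    have "\<exists>x. x \<in> carrier_vec K \<and> ?f x = c" using that unfolding code_of_def by blast
    then show ?thesis unfolding g_def by (rule someI_ex)
  qed
  have f_mem: "?f x \<in> ?C" if "x \<in> carrier_vec K" for x using that by (auto simp: code_of_def)
  have res: "residues (g (?f x)) = residues x" if "x \<in> carrier_vec K" for x
    using g[OF f_mem[OF that]] f_eq[OF _ that] by blast
  have "bij_betw (\<lambda>c. residues (g c)) ?C residue_module"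
    unfolding bij_betw_def
  proof
    show "inj_on (\<lambda>c. residues (g c)) ?C"
    proof (rule inj_onI)
      fix c d assume c: "c \<in> ?C" and d: "d \<in> ?C" and "residues (g c) = residues (g d)"
      then have "?f (g c) = ?f (g d)" using g[OF c] g[OF d] f_eq[of "g c" "g d"] by blast
      then show "c = d" using g[OF c] g[OF d] by (simp only:)
    qed
    show "(\<lambda>c. residues (g c)) ` ?C = residue_module"
    proof
      show "(\<lambda>c. residues (g c)) ` ?C \<subseteq> residue_module" using residues_mem by blast
      show "residue_module \<subseteq> (\<lambda>c. residues (g c)) ` ?C"
      proof
        fix m assume "m \<in> residue_module"
        then obtain x where "x \<in> carrier_vec K" "m = residues x" by (rule residues_surj)
        then show "m \<in> (\<lambda>c. residues (g c)) ` ?C"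
          using res[of x] f_mem[of x] by (intro image_eqI[of _ _ "?f x"]) simp_all
      qed
    qed
  qed
  moreover have "residues (g (c + d)) p = residues (g c) p + residues (g d) p"
    if "c \<in> ?C" "d \<in> ?C" "p \<in> subtype_index \<gamma> k" for c d p
  proof -
    note gc = g[OF that(1)] and gd = g[OF that(2)]
    have "?f (g c + g d) = c + d" using f_add[of "g c" "g d"] gc gd by (simp only:)
    then have "residues (g (c + d)) = residues (g c + g d)"
      using res[of "g c + g d"] gc gd by (simp only: add_carrier_vec)
    then show ?thesis using residues_add[of "g c" "g d" p] gc gd that(3) by (simp only:)
  qed
  moreover have "residues (g (r \<cdot>\<^sub>v c)) p = quot_scale (subtype_ideal \<gamma> p) r (residues (g c) p)"
    if "c \<in> ?C" "p \<in> subtype_index \<gamma> k" for r c p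
  proof -
    note gc = g[OF that(1)]
    have "?f (r \<cdot>\<^sub>v g c) = r \<cdot>\<^sub>v c" using f_smult[of "g c" r] gc by (simp only:)
    then have "residues (g (r \<cdot>\<^sub>v c)) = residues (r \<cdot>\<^sub>v g c)"
      using res[of "r \<cdot>\<^sub>v g c"] gc by (simp only: smult_carrier_vec)
    then show ?thesis using residues_smult[of "g c" p r] gc that(2) by (simp only:)
  qed
  ultimately show ?thesis unfolding has_subtype_def by blast
qed

text \<open>By cardinality, since \<open>h\<close> generates a code with the same number of elements as
  the columns provided by the subtype.\<close>

lemma kernel_of_columns:
  assumes h: "\<And>j. j < n \<Longrightarrow> h j \<in> columns"
    and sub: "linear_code n (code_of K n h)" "has_subtype \<gamma> k (code_of K n h)"
  shows "{x \<in> carrier_vec K. \<forall>j<n. h j \<bullet> x = 0} = relations"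
proof -
  obtain h' where h'_columns: "\<forall>j<n. h' j \<in> columns" and h': "code_of K n h = code_of K n h'"
    "{x \<in> carrier_vec K. \<forall>j<n. h' j \<bullet> x = 0} = relations"
    using columns_of_subtype[OF sub] .
  let ?c = "card (code_of K n h)"
  let ?ker = "{x \<in> carrier_vec K. \<forall>j<n. h j \<bullet> x = 0}"
  have fin: "finite (carrier_vec K :: 'a vec set)" by (rule finite_carrier_vec_finite)
  have eq: "card (carrier_vec K :: 'a vec set) = ?c * card ?ker"
    by (rule card_code_of) (rule columns_carrier[OF h])
  have "card (carrier_vec K :: 'a vec set) = card (code_of K n h') * card {x \<in> carrier_vec K. \<forall>j<n. h' j \<bullet> x = 0}"
    using h'_columns by (intro card_code_of columns_carrier) blast
  then have eq': "card (carrier_vec K :: 'a vec set) = ?c * card relations"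
    unfolding h' .
  have "card (carrier_vec K :: 'a vec set) > 0"
    using fin zero_carrier_vec[of K] by (auto simp only: card_gt_0_iff)
  then have "?c > 0" unfolding eq by (rule contrapos_pp) simp
  then have "card relations = card ?ker" using eq eq' by simp
  moreover have "relations \<subseteq> ?ker"
    using relations_annihilate h by (auto simp: relations_def)
  moreover have "finite ?ker" using fin by simp
  ultimately show ?thesis using card_subset_eq[of ?ker relations] by simp
qed

lemma constant_weight_code_columns:
  assumes "constant_weight_code \<gamma> k n C"
  obtains h l where "\<forall>j<n. h j \<in> columns" "C = code_of K n h" "l > 0"
    "\<forall>v\<in>columns - {0\<^sub>v K}.
      real (card {j \<in> {..<n}. h j \<in> unit_orbit v}) = real l / (real q - 1) * real (card (unit_orbit v))"
proof -
  obtain w where w: "constant_weight \<gamma> n C w" and lin: "linear_code n C" and sub: "has_subtype \<gamma> k C"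
    using assms by (auto simp: constant_weight_code_def)
  obtain h where h_columns: "\<forall>j<n. h j \<in> columns" and h: "C = code_of K n h"
    "{x \<in> carrier_vec K. \<forall>j<n. h j \<bullet> x = 0} = relations"
    using columns_of_subtype[OF lin sub] .
  then have hV: "h j \<in> columns" if "j < n" for j using that by blast
  have "\<forall>x\<in>carrier_vec K - relations. (\<Sum>j\<in>{..<n}. wt_elem \<gamma> (h j \<bullet> x)) = w"
    using constant_weight_code_of_iff[of n h w, OF hV h(2)] w unfolding h(1) by (simp only:)
  then have wt: "(\<Sum>j\<in>{..<n}. wt_elem \<gamma> (h j \<bullet> x)) = w" if "x \<in> carrier_vec K - relations" for x
    using that by (rule bspec)
  have ker: "\<exists>j\<in>{..<n}. h j \<bullet> x \<noteq> 0" if "x \<in> carrier_vec K - relations" for x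
    using that unfolding h(2)[symmetric] by auto
  have hJ: "h j \<in> columns" if "j \<in> {..<n}" for j using hV that by simp
  show thesis
  proof (rule constant_weight_multiplicity[OF finite_lessThan hJ ker wt])
    fix l :: nat
    assume "l > 0" and mult: "\<And>v. v \<in> columns - {0\<^sub>v K} \<Longrightarrow>
      real (card {j \<in> {..<n}. h j \<in> unit_orbit v}) = real l / (real q - 1) * real (card (unit_orbit v))"
    then show thesis by (intro that[OF h_columns h(1)] ballI)
  qed
qed

lemma balanced_columns_iff:
  "balanced_columns \<gamma> k n G \<longleftrightarrow> (\<forall>v\<in>columns - {0\<^sub>v K}.
     real (card {j \<in> {..<n}. col G j \<in> unit_orbit v}) = 1 / (real q - 1) * real (card (unit_orbit v)))"
proof -
  have "unit_orbit v = {0\<^sub>v K} \<longleftrightarrow> v = 0\<^sub>v K" for v :: "'a vec"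
  proof
    assume "unit_orbit v = {0\<^sub>v K}"
    then show "v = 0\<^sub>v K" using mem_unit_orbit_self[of v] by blast
  qed (simp only: unit_orbit_zero)
  then have "nonzero_orbits \<gamma> k = unit_orbit ` (columns - {0\<^sub>v K})"
    unfolding nonzero_orbits_def column_space_eq by blast
  then show ?thesis by (simp add: balanced_columns_def)
qed

text \<open>The product over rows is regrouped into blocks, on which the level is constant.\<close>

lemma card_column_space: "card columns = (\<Prod>i<s. q ^ (k i * (s - i)))"
proof -
  have "card columns = (\<Prod>r\<in>{..<K}. q ^ (s - level r))" by (rule card_columns)
  also have "\<dots> = (\<Prod>p\<in>subtype_index \<gamma> k. q ^ (s - level (block_position k p)))"
    by (rule prod.reindex_bij_betw[OF bij_block_position, symmetric])
  also have "\<dots> = (\<Prod>p\<in>subtype_index \<gamma> k. q ^ (s - fst p))"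
    by (simp add: level_block_position)
  also have "\<dots> = (\<Prod>i<s. \<Prod>j<k i. q ^ (s - i))"
    unfolding subtype_index_def by (subst prod.Sigma) (auto simp: case_prod_beta)
  also have "\<dots> = (\<Prod>i<s. q ^ (k i * (s - i)))"
    by (simp add: power_mult[symmetric] mult.commute)
  finally show ?thesis .
qed

end

text \<open>Stated with \<open>l * n = n\<close> instead of \<open>l = 1\<close> to include the
  empty length, where \<open>l\<close> is not determined.\<close>

lemma replication_same_length:
  assumes "C \<subseteq> carrier_vec n" "l * n = n"
  shows "replication l C = C"
proof -
  have "vec (l * dim_vec c) (\<lambda>i. c $ (i mod dim_vec c)) = c" if "c \<in> C" for c
    using that assms by (intro eq_vecI) auto
  then show ?thesis unfolding replication_def by simp
qed

section \<open>Classification of the constant weight codes\<close>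

context subtype_chain_ring
begin

theorem constant_weight_classification:
  "\<exists>n C. minimal_constant_weight_code \<gamma> k n C \<and>
      (\<forall>n' C'. minimal_constant_weight_code \<gamma> k n' C' \<longrightarrow> n' = n \<and> code_equiv n C C') \<and>
      (\<exists>G. generator_matrix K n G C \<and> (\<forall>j<n. col G j \<in> columns)) \<and>
      (\<forall>G. generator_matrix K n G C \<and> (\<forall>j<n. col G j \<in> columns) \<longrightarrow> balanced_columns \<gamma> k n G) \<and>
      real n = (real (card columns) - 1) / (real q - 1) \<and>
      constant_weight \<gamma> n C (real (card columns) / (real q - 1)) \<and>
      (\<forall>n' C'. constant_weight_code \<gamma> k n' C' \<longrightarrow>
        (\<exists>l>0. code_equiv n' (append_zeros (card (zero_coords n' C')) (replication l C)) C'))"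
proof -
  obtain n :: nat and h :: "nat \<Rightarrow> 'a vec" where h_all: "\<forall>j<n. h j \<in> columns - {0\<^sub>v K}"
    and mult_all: "\<forall>v\<in>columns - {0\<^sub>v K}.
      real (card {j \<in> {..<n}. h j \<in> unit_orbit v}) = 1 / (real q - 1) * real (card (unit_orbit v))"
    using balanced_columns_exist .
  have h: "h j \<in> columns - {0\<^sub>v K}" if "j < n" for j using h_all that by blast
  have mult: "real (card {j \<in> {..<n}. h j \<in> unit_orbit v}) = 1 / (real q - 1) * real (card (unit_orbit v))"
    if "v \<in> columns - {0\<^sub>v K}" for v
    using mult_all that by (rule bspec)
  have hV: "h j \<in> columns" if "j < n" for j using h[OF that] by simp
  have hJ: "h j \<in> columns" if "j \<in> {..<n}" for j using hV that by simp
  have hK: "h j \<in> carrier_vec K" if "j < n" for j using columns_carrier[OF hV[OF that]] .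
  let ?C = "code_of K n h"
  have V_pos: "card columns > 0" using finite_columns zero_columns by (auto simp: card_gt_0_iff)
  have q: "real q - 1 > 0" using q_ge_2 by simp
  have weight: "(\<Sum>j<n. wt_elem \<gamma> (h j \<bullet> x)) = real (card columns) / (real q - 1)"
    if "x \<in> carrier_vec K - relations" for x
    using columns_weight[OF finite_lessThan hJ mult, of x] that by simp
  \<comment> \<open>A vector killed by all columns has weight 0, while one outside
    \<open>relations\<close> has the positive weight \<open>card columns / (q - 1)\<close>.\<close>
  have ker: "{x \<in> carrier_vec K. \<forall>j<n. h j \<bullet> x = 0} = relations"
  proof (intro equalityI subsetI)
    fix x assume x: "x \<in> {x \<in> carrier_vec K. \<forall>j<n. h j \<bullet> x = 0}"
    show "x \<in> relations"
    proof (rule ccontr)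
      assume "x \<notin> relations"
      then have "(\<Sum>j<n. wt_elem \<gamma> (h j \<bullet> x)) > 0" using weight[of x] x V_pos q by simp
      moreover have "(\<Sum>j<n. wt_elem \<gamma> (h j \<bullet> x)) = 0" using x by (intro sum.neutral) simp
      ultimately show False by simp
    qed
  next
    fix x assume "x \<in> relations"
    then show "x \<in> {x \<in> carrier_vec K. \<forall>j<n. h j \<bullet> x = 0}"
      using relations_annihilate[OF hV] by (simp add: relations_def)
  qed
  have C_lin: "linear_code n ?C" using hK by (rule linear_code_code_of)
  have C_sub: "has_subtype \<gamma> k ?C" using hV ker by (rule has_subtype_code_of)
  have C_weight: "constant_weight \<gamma> n ?C (real (card columns) / (real q - 1))"
    using constant_weight_code_of_iff[of n h "real (card columns) / (real q - 1)", OF hV ker]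
      ballI[OF weight] by (simp only:)
  have C_code: "constant_weight_code \<gamma> k n ?C"
    unfolding constant_weight_code_def using C_lin C_sub C_weight by blast
  have "{j \<in> {..<n}. h j \<noteq> 0\<^sub>v K} = {..<n}" using h by auto
  then have len: "real n = (real (card columns) - 1) / (real q - 1)"
    using card_nonzero_columns[OF finite_lessThan hJ mult] by simp
  \<comment> \<open>The length equation is carried along because minimality and uniqueness are both
    read off from it.\<close>
  have repl: "\<exists>l>0. n' = l * n + card (zero_coords n' C') \<and>
      code_equiv n' (append_zeros (card (zero_coords n' C')) (replication l ?C)) C'"
    if C': "constant_weight_code \<gamma> k n' C'" for n' C'
  proof -
    obtain h' l where h'_all: "\<forall>j<n'. h' j \<in> columns" and h': "C' = code_of K n' h'" "l > 0"
      and mult'_all: "\<forall>v\<in>columns - {0\<^sub>v K}.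
        real (card {j \<in> {..<n'}. h' j \<in> unit_orbit v}) = real l / (real q - 1) * real (card (unit_orbit v))"
      using constant_weight_code_columns[OF C'] .
    have h'V: "h' j \<in> columns" if "j < n'" for j using h'_all that by blast
    note mult' = bspec[OF mult'_all]
    show ?thesis
      unfolding h'(1)
      by (intro exI[of _ l] conjI h'(2) replication_equiv[OF h mult h'V mult' refl])
  qed
  have minimal: "minimal_constant_weight_code \<gamma> k n ?C"
    unfolding minimal_constant_weight_code_def
  proof (intro conjI allI impI C_code)
    fix m D assume "constant_weight_code \<gamma> k m D"
    then obtain l where "l > 0" "m = l * n + card (zero_coords m D)" using repl by blast
    moreover have "n \<le> l * n" using \<open>l > 0\<close> by simp
    ultimately show "n \<le> m" by linarith
  qed
  have unique: "n' = n \<and> code_equiv n ?C C'" if C': "minimal_constant_weight_code \<gamma> k n' C'" for n' C'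
  proof -
    have n': "n' = n"
      using C' minimal unfolding minimal_constant_weight_code_def by (meson le_antisym)
    have "constant_weight_code \<gamma> k n' C'" using C' by (simp add: minimal_constant_weight_code_def)
    then obtain l where l: "l > 0" "n' = l * n + card (zero_coords n' C')"
      "code_equiv n' (append_zeros (card (zero_coords n' C')) (replication l ?C)) C'" using repl by blast
    \<comment> \<open>With \<open>n' = n\<close> there is no room for zero coordinates or further
      blocks, so the padded replication is the code itself.\<close>
    have "n \<le> l * n" using l(1) by simp
    then have "card (zero_coords n' C') = 0" and "l * n = n" using l(2) n' by linarith+
    moreover have "?C \<subseteq> carrier_vec n" by (auto simp: code_of_def)
    ultimately show ?thesis
      using l(3) n' replication_same_length[of ?C n l] by (simp add: append_zeros_0)
  qed
  have balanced: "balanced_columns \<gamma> k n G"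
    if G: "generator_matrix K n G ?C" "\<forall>j<n. col G j \<in> columns" for G
  proof -
    have eq: "?C = code_of K n (col G)" using G(1) by (simp add: generator_matrix_iff)
    have GV: "col G j \<in> columns" if "j < n" for j using G(2) that by blast
    have GJ: "col G j \<in> columns" if "j \<in> {..<n}" for j using G(2) that by blast
    \<comment> \<open>The matrix \<open>G\<close> is arbitrary, so its kernel is not known by
      construction; it follows from the subtype of the code. The known weight then fixes the
      multiplicities.\<close>
    have kerG: "{x \<in> carrier_vec K. \<forall>j<n. col G j \<bullet> x = 0} = relations"
      using kernel_of_columns[of n "col G", OF GV] C_lin C_sub unfolding eq by (simp only:)
    have "\<forall>x\<in>carrier_vec K - relations.
        (\<Sum>j\<in>{..<n}. wt_elem \<gamma> (col G j \<bullet> x)) = real (card columns) / (real q - 1)"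
      using constant_weight_code_of_iff[of n "col G", OF GV kerG] C_weight unfolding eq by (simp only:)
    then have wtG: "(\<Sum>j\<in>{..<n}. wt_elem \<gamma> (col G j \<bullet> x)) = real (card columns) / (real q - 1)"
      if "x \<in> carrier_vec K - relations" for x
      using that by (rule bspec)
    show ?thesis
      unfolding balanced_columns_iff
    proof
      fix v assume v: "v \<in> columns - {0\<^sub>v K}"
      show "real (card {j \<in> {..<n}. col G j \<in> unit_orbit v}) = 1 / (real q - 1) * real (card (unit_orbit v))"
        using orbit_multiplicity[OF finite_lessThan GJ wtG v] V_pos by simp
    qed
  qed
  obtain G where "generator_matrix K n G ?C" "\<forall>j<n. col G j = h j"
    using generator_matrix_of_columns[OF hK] .
  then have "generator_matrix K n G ?C \<and> (\<forall>j<n. col G j \<in> columns)" using hV by simp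
  then have "\<exists>G. generator_matrix K n G ?C \<and> (\<forall>j<n. col G j \<in> columns)" by (rule exI)
  moreover have "\<forall>n' C'. minimal_constant_weight_code \<gamma> k n' C' \<longrightarrow> n' = n \<and> code_equiv n ?C C'"
    using unique by (intro allI impI)
  moreover have "\<forall>G. generator_matrix K n G ?C \<and> (\<forall>j<n. col G j \<in> columns) \<longrightarrow> balanced_columns \<gamma> k n G"
    by (intro allI impI, elim conjE) (rule balanced)
  moreover have "\<forall>n' C'. constant_weight_code \<gamma> k n' C' \<longrightarrow>
      (\<exists>l>0. code_equiv n' (append_zeros (card (zero_coords n' C')) (replication l ?C)) C')"
    using repl by blast
  ultimately show ?thesis
    using minimal len C_weight by (intro exI[of _ n] exI[of _ ?C] conjI)
qed

end

theorem theorem39: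
  fixes \<gamma> :: "'a::{comm_ring_1,finite}" and k :: "nat \<Rightarrow> nat" and s q K :: nat and V :: "'a vec set"
  assumes "chain_ring TYPE('a)" and "maximal_ideal (ideal_gen \<gamma>)"
    and "s = nilpotency_index \<gamma>" and "q = residue_size \<gamma>"
    and "K = code_rank \<gamma> k" and "V = column_space \<gamma> k"
  shows "card V = (\<Prod>i<s. q ^ (k i * (s - i))) \<and>
    (\<exists>n C. minimal_constant_weight_code \<gamma> k n C \<and>
      (\<forall>n' C'. minimal_constant_weight_code \<gamma> k n' C' \<longrightarrow> n' = n \<and> code_equiv n C C') \<and>
      (\<exists>G. generator_matrix K n G C \<and> (\<forall>j<n. col G j \<in> V)) \<and>
      (\<forall>G. generator_matrix K n G C \<and> (\<forall>j<n. col G j \<in> V) \<longrightarrow> balanced_columns \<gamma> k n G) \<and>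
      real n = (real (card V) - 1) / (real q - 1) \<and>
      constant_weight \<gamma> n C (real (card V) / (real q - 1)) \<and>
      (\<forall>n' C'. constant_weight_code \<gamma> k n' C' \<longrightarrow>
        (\<exists>l>0. code_equiv n' (append_zeros (card (zero_coords n' C')) (replication l C)) C')))"
proof -
  interpret subtype_chain_ring \<gamma> k
    using assms(1,2) by unfold_locales
  show ?thesis
    unfolding assms(3-6) column_space_eq
    using card_column_space constant_weight_classification by (rule conjI)
qed

end
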